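(* Let $a,b,x,y,z,t$ be non-negative integers and let $Q=Q_{a,b}(x,y,z,t)$ be the region defined in the context. Assign to every left lozenge of $Q$ the weight $q^{l}$, where $l$ is the distance between the horizontal line containing the top side of the lozenge and the line containing the S side (bottom) of $Q$, and weight $1$ to every right and vertical lozenge; let $\operatorname{M}_3(Q)$ be the resulting tiling generating function. Then \begin{align*} \operatorname{M}_3(Q)&=q^{b\binom{a+y+1}{2}+y\binom{a+y+t+1}{2}+x\binom{y+t+1}{2}}\frac{\operatorname{H}_q(x)\operatorname{H}_q(y)\operatorname{H}_q(z)\operatorname{H}_q(t)\operatorname{H}_q(a)\operatorname{H}_q(b)}{\operatorname{H}_q(a+x)\operatorname{H}_q(b+t)\operatorname{H}_q(a+b+y)}\\ &\times\frac{\operatorname{H}_q(a+b+x+2y+z+t)\operatorname{H}_q(a+b+x+y+t)}{\operatorname{H}_q(a+b+y+z+t)\operatorname{H}_q(a+b+x+2y+t)\operatorname{H}_q(a+b+x+y+z)}\\ &\times \frac{\operatorname{H}_q(a+x+y)\operatorname{H}_q(b+y+t)\operatorname{H}_q(a+b+y+z)^2}{\operatorname{H}_q(x+y+t)\operatorname{H}_q(a+y+z)\operatorname{H}_q(b+y+z)}. \end{align*}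
   Context: Triangular lattice drawn with one family of lattice lines horizontal; a lozenge is a union of two unit triangles sharing an edge; lozenge tilings cover a region without gaps or overlaps; the tiling generating function is the sum over tilings of the products of lozenge weights. Hexagon sides are listed clockwise NW, N, NE, SE, S, SW, with N and S horizontal. A right lozenge has two horizontal sides and the other two parallel to the NW side ("/"); a left lozenge has two horizontal sides and the other two parallel to the NE side ("\"); a vertical lozenge has no horizontal side. Distances between horizontal lines are counted in lattice rows. The region $Q_{a,b}(x,y,z,t)$: take the hexagon with sides NW $z+a+b$, N $x+y$, NE $y+t+a+b$, SE $z$, S $x+y+a+b$, SW $y+t$. Remove the equilateral triangle of side $b$ lying in the hexagon and having as one side the segment of the NE side whose upper endpoint is at distance $t$ from the N/NE corner (the part of the NE side below it has length $y+a$); and remove the up-pointing triangle of side $a$ whose base is the segment of the S side whose left endpoint is at distance $x$ from the SW/S corner (the part to its right has length $y+b$). $q$-notation: $[n]_q=1+q+\dots+q^{n-1}$, $[n]_q!=[1]_q\cdots[n]_q$, $[0]_q!=1$, $\operatorname{H}_q(n)=[0]_q![1]_q!\cdots[n-1]_q!$. *)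

theory Defs
  imports "HOL-Computational_Algebra.Computational_Algebra" "HOL-Library.Disjoint_Sets"
begin

text \<open>
  The lattice point \<open>(i, j)\<close> stands for \<open>i (1, 0) + j (1/2, sqrt 3 / 2)\<close>, so \<open>j\<close> counts
  lattice rows, the lines of slope ``/'' are those with \<open>i\<close> constant and the lines of
  slope ``\'' are those with \<open>i + j\<close> constant.
\<close>

type_synonym lpoint = "int \<times> int"

datatype utri = Up int int | Down int int

fun verts :: "utri \<Rightarrow> lpoint set" where
  "verts (Up i j) = {(i, j), (i + 1, j), (i, j + 1)}"
| "verts (Down i j) = {(i + 1, j), (i, j + 1), (i + 1, j + 1)}"

text \<open>Regions are finite sets of unit triangles.\<close>

definition tris :: "lpoint set \<Rightarrow> utri set" where
  "tris S = {T. verts T \<subseteq> S}"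

definition is_lozenge :: "utri set \<Rightarrow> bool" where
  "is_lozenge L \<longleftrightarrow> (\<exists>T T'. L = {T, T'} \<and> card (verts T \<inter> verts T') = 2)"

text \<open>
  Sides of slope ``/'' for the right lozenge (removed diagonal: slope ``\''), and of slope
  ``\'' for the left lozenge (removed diagonal: slope ``/'').
\<close>

definition is_right_lozenge :: "utri set \<Rightarrow> bool" where
  "is_right_lozenge L \<longleftrightarrow> (\<exists>i j. L = {Up i j, Down i j})"

definition is_left_lozenge :: "utri set \<Rightarrow> bool" where
  "is_left_lozenge L \<longleftrightarrow> (\<exists>i j. L = {Up i j, Down (i - 1) j})"

definition is_vertical_lozenge :: "utri set \<Rightarrow> bool" where
  "is_vertical_lozenge L \<longleftrightarrow> (\<exists>i j. L = {Up i j, Down i (j - 1)})"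

definition lozenge_tilings :: "utri set \<Rightarrow> utri set set set" where
  "lozenge_tilings R = {P. partition_on R P \<and> (\<forall>L\<in>P. is_lozenge L)}"

definition tiling_gf :: "(utri set \<Rightarrow> 'a::comm_semiring_1) \<Rightarrow> utri set \<Rightarrow> 'a" where
  "tiling_gf w R = (\<Sum>P\<in>lozenge_tilings R. \<Prod>L\<in>P. w L)"

definition top_height :: "utri set \<Rightarrow> int" where
  "top_height L = Max (snd ` (\<Union>T\<in>L. verts T))"

text \<open>
  The bottom of every region considered lies on the line \<open>j = 0\<close>, so \<open>top_height L\<close> is the
  distance of the top side of \<open>L\<close> from the bottom (and is positive).
\<close>

definition wt3 :: "'a::comm_semiring_1 \<Rightarrow> utri set \<Rightarrow> 'a" where
  "wt3 q L = (if is_left_lozenge L then q ^ nat (top_height L) else 1)"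

definition M3 :: "'a::comm_semiring_1 \<Rightarrow> utri set \<Rightarrow> 'a" where
  "M3 q R = tiling_gf (wt3 q) R"

text \<open>
  \<open>hexagon nw sw s se\<close> has its SW/S corner at the origin. Its corners, clockwise from there, are
  \<open>(0, 0)\<close>, \<open>(-sw, sw)\<close>, \<open>(-sw, sw + nw)\<close>, \<open>(s + se - sw - nw, sw + nw)\<close>, \<open>(s, se)\<close>,
  \<open>(s, 0)\<close>; hence the N side has length \<open>s + se - nw\<close> and the NE side \<open>nw + sw - se\<close>.
\<close>

definition hexagon :: "nat \<Rightarrow> nat \<Rightarrow> nat \<Rightarrow> nat \<Rightarrow> lpoint set" where
  "hexagon nw sw s se = {(i, j).
     0 \<le> j \<and> j \<le> int (sw + nw) \<and>
     - int sw \<le> i \<and> i \<le> int s \<and>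
     0 \<le> i + j \<and> i + j \<le> int (s + se)}"

definition up_triangle :: "int \<Rightarrow> int \<Rightarrow> nat \<Rightarrow> lpoint set" where
  "up_triangle i\<^sub>0 j\<^sub>0 n = {(i, j). i\<^sub>0 \<le> i \<and> j\<^sub>0 \<le> j \<and> i + j \<le> i\<^sub>0 + j\<^sub>0 + int n}"

text \<open>
  With these side lengths the N and NE sides of the hexagon have lengths \<open>x + y\<close> and
  \<open>y + t + a + b\<close>, and the N/NE corner is \<open>(x - t, y + z + t + a + b)\<close>. The point at distance
  \<open>t\<close> from it on the NE side is \<open>(x, y + z + a + b)\<close>, so the segment of length \<open>b\<close> below it ends
  at \<open>(x + b, y + z + a)\<close>. The equilateral triangle on the inner side of this segment is
  up-pointing with third vertex \<open>(x, y + z + a)\<close>.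
\<close>

definition Q_region :: "nat \<Rightarrow> nat \<Rightarrow> nat \<Rightarrow> nat \<Rightarrow> nat \<Rightarrow> nat \<Rightarrow> utri set" where
  "Q_region a b x y z t =
     tris (hexagon (z + a + b) (y + t) (x + y + a + b) z)
     - tris (up_triangle (int x) (int (y + z + a)) b)
     - tris (up_triangle (int x) 0 a)"

definition qint :: "'a::comm_semiring_1 \<Rightarrow> nat \<Rightarrow> 'a" where
  "qint q n = (\<Sum>k<n. q ^ k)"

definition qfact :: "'a::comm_semiring_1 \<Rightarrow> nat \<Rightarrow> 'a" where
  "qfact q n = (\<Prod>k=1..n. qint q k)"

definition qH :: "'a::comm_semiring_1 \<Rightarrow> nat \<Rightarrow> 'a" where
  "qH q n = (\<Prod>k<n. qfact q k)"

lemma is_lozenge_iff: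
  "is_lozenge L \<longleftrightarrow> is_right_lozenge L \<or> is_left_lozenge L \<or> is_vertical_lozenge L"
proof
  assume "is_lozenge L"
  then obtain T T' where L: "L = {T, T'}" and c: "card (verts T \<inter> verts T') = 2"
    by (auto simp: is_lozenge_def)
  from c obtain u v where uv: "verts T \<inter> verts T' = {u, v}" "u \<noteq> v"
    by (auto simp: card_2_iff)
  then have m: "u \<in> verts T" "u \<in> verts T'" "v \<in> verts T" "v \<in> verts T'"
    by blast+
  obtain u1 u2 v1 v2 where p: "u = (u1, u2)" "v = (v1, v2)"
    by (metis surj_pair)
  have ne: "T \<noteq> T'"
  proof
    assume "T = T'"
    then have "card (verts T) = 2" using c by simp
    then show False by (cases T) auto
  qed
  show "is_right_lozenge L \<or> is_left_lozenge L \<or> is_vertical_lozenge L"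
  proof (cases T; cases T')
    fix i j k l assume "T = Up i j" "T' = Up k l"
    then have False using m uv(2) ne unfolding p by simp (elim disjE conjE; simp; linarith?)
    then show ?thesis ..
  next
    fix i j k l assume "T = Down i j" "T' = Down k l"
    then have False using m uv(2) ne unfolding p by simp (elim disjE conjE; simp; linarith?)
    then show ?thesis ..
  next
    fix i j k l assume *: "T = Up i j" "T' = Down k l"
    then have "k = i \<and> l = j \<or> k = i - 1 \<and> l = j \<or> k = i \<and> l = j - 1"
      using m uv(2) unfolding p by simp (elim disjE conjE; simp; linarith?)
    then show ?thesis unfolding L *
      by (auto simp: is_right_lozenge_def is_left_lozenge_def is_vertical_lozenge_def)
  next
    fix i j k l assume *: "T = Down i j" "T' = Up k l"
    then have "i = k \<and> j = l \<or> i = k - 1 \<and> j = l \<or> i = k \<and> j = l - 1"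
      using m uv(2) unfolding p by simp (elim disjE conjE; simp; linarith?)
    then show ?thesis unfolding L *
      by (auto simp: is_right_lozenge_def is_left_lozenge_def is_vertical_lozenge_def insert_commute)
  qed
next
  have 1: "verts (Up i j) \<inter> verts (Down i j) = {(i + 1, j), (i, j + 1)}" for i j by auto
  have 2: "verts (Up i j) \<inter> verts (Down (i - 1) j) = {(i, j), (i, j + 1)}" for i j by auto
  have 3: "verts (Up i j) \<inter> verts (Down i (j - 1)) = {(i, j), (i + 1, j)}" for i j by auto
  have c: "card (verts (Up i j) \<inter> verts (Down i j)) = 2"
    "card (verts (Up i j) \<inter> verts (Down (i - 1) j)) = 2"
    "card (verts (Up i j) \<inter> verts (Down i (j - 1))) = 2" for i j
    unfolding 1 2 3 by simp_all
  assume "is_right_lozenge L \<or> is_left_lozenge L \<or> is_vertical_lozenge L"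
  then show "is_lozenge L"
    unfolding is_right_lozenge_def is_left_lozenge_def is_vertical_lozenge_def is_lozenge_def
    using c by blast
qed

lemma top_height_left: "top_height {Up i j, Down (i - 1) j} = j + 1"
  by (simp add: top_height_def max_def)

lemma finite_hexagon: "finite (hexagon nw sw s se)"
  by (rule finite_subset[of _ "{- int sw..int s} \<times> {0..int (sw + nw)}"])
     (auto simp: hexagon_def)

lemma finite_tris:
  assumes "finite S"
  shows "finite (tris S)"
proof -
  let ?B = "case_prod Up ` S \<union> (\<lambda>(i, j). Down (i - 1) j) ` S"
  have "tris S \<subseteq> ?B"
  proof
    fix T assume T: "T \<in> tris S"
    show "T \<in> ?B"
    proof (cases T)
      case (Up i j)
      then have "(i, j) \<in> S" using T by (simp add: tris_def)
      then show ?thesis using Up by force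
    next
      case (Down i j)
      then have "(i + 1, j) \<in> S" using T by (simp add: tris_def)
      then show ?thesis using Down by force
    qed
  qed
  then show ?thesis using assms by (meson finite_UnI finite_imageI finite_subset)
qed

lemma finite_Q_region: "finite (Q_region a b x y z t)"
  by (simp add: Q_region_def finite_tris finite_hexagon)

lemma finite_lozenge_tilings:
  assumes "finite R"
  shows "finite (lozenge_tilings R)" "P \<in> lozenge_tilings R \<Longrightarrow> finite P"
  using finitely_many_partition_on[OF assms] finite_elements[OF assms]
  by (auto simp: lozenge_tilings_def intro: finite_subset[rotated])

text \<open>The indeterminate of the field of rational functions.\<close>

lemma qint_indeterminate_nonzero:
  assumes "n > 0"
  shows "qint (to_fract ([:0, 1:] :: 'a::idom poly)) n \<noteq> 0"
proof -
  have pow: "to_fract p ^ k = to_fract (p ^ k)" for p :: "'a poly" and k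
    by (induction k) simp_all
  have "qint (to_fract ([:0, 1:] :: 'a poly)) n = to_fract (qint [:0, 1:] n)"
    unfolding qint_def by (induction n) (simp_all add: pow)
  moreover have "poly (qint ([:0, 1:] :: 'a poly) n) 0 = 1"
    using assms by (simp add: qint_def poly_sum power_0_left)
  then have "qint ([:0, 1:] :: 'a poly) n \<noteq> 0" by auto
  ultimately show ?thesis by simp
qed

end

theory Submission
  imports Defs "Jordan_Normal_Form.Determinant"
begin

text \<open>
  Cut \<open>Q\<close> along the lattice lines of slope ``/''. On each line, record the unit segments not crossed by
  a left lozenge. Right and vertical lozenges move these holes by \<open>0\<close> or \<open>- 1\<close>, so a tiling becomes a family of
  non-intersecting paths, and the weight of a tiling is a constant times \<open>q\<close> to the negative sum of the
  hole positions. Path families that start or end in an interval are counted by a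
  Vandermonde product in the powers \<open>q ^ i\<close>, where \<open>i\<close> runs over the complementary positions.

  The left sides of both removed triangles lie on the line \<open>i = x\<close>. Cutting there, \<open>M3\<close> becomes a sum
  over hole sets \<open>H\<close> of products of two Vandermonde products. The identity
  \<open>D(T \<union> Y) D(T \<union> Z) D(Y \<union> Z) = D(T \<union> Y \<union> Z) D(T) D(Y) D(Z)\<close>
  turns each summand, up to a factor independent of \<open>H\<close>, into the corresponding
  summand for \<open>z\<close> paths between two intervals, that is, for a hexagon without holes. The latter sum is again
  a single Vandermonde quotient.

  All of this is done for an indeterminate \<open>q\<close>, so that division by \<open>q\<close> and \<open>q ^ n - 1\<close> is harmless.
\<close>

section \<open>Vandermonde determinants\<close>

text \<open>Non-intersection costs nothing: a step that makes two holes collide also makes the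
  Vandermonde product at the new positions vanish. A step sum may thus run over all subsets of the
  holes, and multilinearity in the rows turns it into one determinant.

  The sets in the identity are read off the cut. \<open>T\<close> consists of the segments crossed
  by left lozenges, \<open>Z\<close> of the left sides of the removed triangles, and
  \<open>Y\<close> of the positions beyond the hexagon that unrestricted paths from the NW side
  could reach. The triangle sides are holes for the left part only, so the complement of the holes
  is \<open>T \<union> Y\<close> on the left and \<open>T \<union> Z\<close> on the right. The
  identity trades this pair for \<open>T \<union> Y \<union> Z\<close> and \<open>T\<close>, the
  complements of \<open>H\<close> alone in a longer and in a shorter interval: the gaps are absorbed
  into the numbers of steps.

  The formula also covers q = 0, and q = 1 in characteristic 0, where the intermediate denominators
  vanish. Hence the identity is proved with denominators cleared and evaluated only at the
  end.\<close>

definition vand :: "nat \<Rightarrow> (nat \<Rightarrow> 'a::comm_ring_1) \<Rightarrow> 'a" where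
  "vand n x = (\<Prod>j<n. \<Prod>i<j. x j - x i)"

text \<open>Passing to the monomial basis is multiplication by an upper triangular matrix. Used
  twice: with the Newton basis it gives the Vandermonde formula, with the images of the monomials
  under a triangular operator it gives the product of the eigenvalues.\<close>

lemma det_poly_basis:
  fixes x :: "nat \<Rightarrow> 'a::comm_ring_1"
  assumes "\<And>j. j < n \<Longrightarrow> degree (p j) \<le> j"
  shows "det (mat n n (\<lambda>(i, j). poly (p j) (x i)))
    = (\<Prod>j<n. coeff (p j) j) * det (mat n n (\<lambda>(i, j). x i ^ j))"
proof -
  let ?V = "mat n n (\<lambda>(i, j). x i ^ j)" and ?A = "mat n n (\<lambda>(k, j). coeff (p j) k)"
  have eq: "mat n n (\<lambda>(i, j). poly (p j) (x i)) = ?V * ?A"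
  proof (rule eq_matI)
    fix i j assume "i < dim_row (?V * ?A)" "j < dim_col (?V * ?A)"
    then have ij: "i < n" "j < n" by auto
    have "poly (p j) (x i) = (\<Sum>k\<in>{0..<n}. coeff (p j) k * x i ^ k)"
      unfolding poly_altdef
      by (rule sum.mono_neutral_left) (use assms[of j] ij in \<open>auto simp: coeff_eq_0\<close>)
    then show "mat n n (\<lambda>(i, j). poly (p j) (x i)) $$ (i, j) = (?V * ?A) $$ (i, j)"
      using ij by (simp add: scalar_prod_def mult.commute)
  qed auto
  have "upper_triangular ?A"
    unfolding upper_triangular_def
  proof (intro allI impI)
    fix i j assume "i < dim_row ?A" "j < i"
    then show "?A $$ (i, j) = 0"
      using assms[of j] by (auto intro: coeff_eq_0)
  qed
  then have "det ?A = prod_list (diag_mat ?A)"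
    by (rule det_upper_triangular[where n = n]) simp
  also have "\<dots> = (\<Prod>j<n. coeff (p j) j)"
    by (simp add: diag_mat_def prod.distinct_set_conv_list[symmetric] atLeast0LessThan)
  finally show ?thesis
    unfolding eq by (subst det_mult[of _ n]) (simp_all add: mult.commute)
qed

lemma det_vandermonde:
  fixes x :: "nat \<Rightarrow> 'a::idom"
  shows "det (mat n n (\<lambda>(i, j). x i ^ j)) = vand n x"
proof -
  \<comment> \<open>The Newton basis: \<open>p j\<close> vanishes at all earlier nodes, so its
    evaluation matrix is lower triangular.\<close>
  define p where "p j = (\<Prod>m<j. [:- x m, 1:])" for j
  have deg: "degree (p j) = j" for j
    unfolding p_def by (subst degree_prod_eq_sum_degree) auto
  have "lead_coeff (p j) = 1" for j
    unfolding p_def lead_coeff_prod by simp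
  then have lc: "coeff (p j) j = 1" for j using deg by metis
  let ?M = "mat n n (\<lambda>(i, j). poly (p j) (x i))"
  have pe: "poly (p j) a = (\<Prod>m<j. a - x m)" for j a
    unfolding p_def poly_prod by simp
  have "det ?M = prod_list (diag_mat ?M)"
    by (rule det_lower_triangular[where n = n]) (auto simp: pe)
  also have "\<dots> = vand n x"
    by (simp add: diag_mat_def prod.distinct_set_conv_list[symmetric] atLeast0LessThan pe vand_def)
  finally show ?thesis
    using det_poly_basis[of n p x] deg lc by simp
qed

text \<open>Every row on the right is a sum of two rows. Expanding all rows at once gives one
  determinant for each set \<open>E\<close> of rows that take the first summand.\<close>

lemma sum_Pow_det_rows:
  fixes u v :: "nat \<Rightarrow> 'a::comm_ring_1"
  shows "(\<Sum>E\<in>Pow {..<n}. (\<Prod>i<n. if i \<in> E then \<alpha> i else \<beta> i)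
      * det (mat n n (\<lambda>(i, j). (if i \<in> E then u i else v i) ^ j)))
    = det (mat n n (\<lambda>(i, j). \<alpha> i * u i ^ j + \<beta> i * v i ^ j))"
proof -
  have split: "(\<Prod>i<n. \<alpha> i * u i ^ p i + \<beta> i * v i ^ p i)
      = (\<Sum>E\<in>Pow {..<n}. (\<Prod>i<n. if i \<in> E then \<alpha> i else \<beta> i)
          * (\<Prod>i<n. (if i \<in> E then u i else v i) ^ p i))" for p
  proof -
    have "(\<Prod>i\<in>E. \<alpha> i * u i ^ p i) * (\<Prod>i\<in>{..<n} - E. \<beta> i * v i ^ p i)
        = (\<Prod>i<n. if i \<in> E then \<alpha> i else \<beta> i) * (\<Prod>i<n. (if i \<in> E then u i else v i) ^ p i)"
      if E: "E \<in> Pow {..<n}" for E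
    proof -
      have "(\<Prod>i<n. if i \<in> E then \<alpha> i else \<beta> i) * (\<Prod>i<n. (if i \<in> E then u i else v i) ^ p i)
          = (\<Prod>i<n. if i \<in> E then \<alpha> i * u i ^ p i else \<beta> i * v i ^ p i)"
        by (simp add: prod.distrib[symmetric] if_distrib cong: if_cong)
          (intro prod.cong; simp)
      also have "\<dots> = (\<Prod>i\<in>E. \<alpha> i * u i ^ p i) * (\<Prod>i\<in>{..<n} - E. \<beta> i * v i ^ p i)"
      proof -
        have "{..<n} \<inter> E = E" "{..<n} \<inter> {i. i \<notin> E} = {..<n} - E" using E by auto
        then show ?thesis
          by (subst prod.If_cases) (simp_all add: Collect_neg_eq)
      qed
      finally show ?thesis ..
    qed
    then show ?thesis by (subst prod_add) (auto intro: sum.cong)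
  qed
  have idx: "(\<Prod>i<n. mat n n f $$ (i, p i)) = (\<Prod>i<n. f (i, p i))"
    if "p permutes {..<n}" for p and f :: "nat \<times> nat \<Rightarrow> 'a"
    using permutes_in_image[OF that] by (intro prod.cong) auto
  have "det (mat n n (\<lambda>(i, j). \<alpha> i * u i ^ j + \<beta> i * v i ^ j))
      = (\<Sum>p | p permutes {0..<n}. signof p * (\<Prod>i<n. \<alpha> i * u i ^ p i + \<beta> i * v i ^ p i))"
    by (subst det_def'[of _ n]) (auto intro!: sum.cong simp: idx atLeast0LessThan)
  also have "\<dots> = (\<Sum>E\<in>Pow {..<n}. \<Sum>p | p permutes {0..<n}.
      (\<Prod>i<n. if i \<in> E then \<alpha> i else \<beta> i)
      * (signof p * (\<Prod>i<n. (if i \<in> E then u i else v i) ^ p i)))"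
    unfolding split sum_distrib_left
    by (subst sum.swap) (simp add: algebra_simps)
  also have "\<dots> = (\<Sum>E\<in>Pow {..<n}. (\<Prod>i<n. if i \<in> E then \<alpha> i else \<beta> i)
      * det (mat n n (\<lambda>(i, j). (if i \<in> E then u i else v i) ^ j)))"
    by (subst det_def'[of _ n]) (auto intro!: sum.cong simp: idx sum_distrib_left atLeast0LessThan)
  finally show ?thesis ..
qed

text \<open>
  The sum applies the operator \<open>f(X) \<mapsto> f(X) - r f(q X) + p (f(q X) - f(X)) / X\<close> to every row of the
  Vandermonde matrix. This operator is triangular on monomials.
\<close>

lemma vand_shift_sum:
  fixes x :: "nat \<Rightarrow> 'a::field"
  assumes "\<And>i. i < n \<Longrightarrow> x i \<noteq> 0"
  shows "(\<Sum>E\<in>Pow {..<n}.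
      (\<Prod>i<n. if i \<in> E then (p - r * x i) / x i else (x i - p) / x i)
      * vand n (\<lambda>i. if i \<in> E then q * x i else x i))
    = (\<Prod>j<n. 1 - r * q ^ j) * vand n x"
proof -
  \<comment> \<open>The image of the monomial of degree j. For j = 0 the second coefficient is zero,
    so the truncated exponent \<open>j - 1\<close> is harmless.\<close>
  define P where "P j = monom (1 - r * q ^ j) j + monom (p * (q ^ j - 1)) (j - 1)" for j
  have deg: "degree (P j) \<le> j" for j
  proof -
    have "degree (P j) \<le> max j (j - 1)"
      unfolding P_def by (rule degree_add_le_max[THEN order_trans])
        (intro max.mono degree_monom_le)
    then show ?thesis by simp
  qed
  have lc: "coeff (P j) j = 1 - r * q ^ j" for j
    by (cases j) (simp_all add: P_def)
  have ev: "(p - r * x i) / x i * (q * x i) ^ j + (x i - p) / x i * x i ^ j = poly (P j) (x i)"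
    if "i < n" for i j
    using assms[OF that]
    by (cases j) (simp_all add: P_def poly_monom field_simps power_mult_distrib)
  have "(\<Sum>E\<in>Pow {..<n}.
      (\<Prod>i<n. if i \<in> E then (p - r * x i) / x i else (x i - p) / x i)
      * vand n (\<lambda>i. if i \<in> E then q * x i else x i))
    = det (mat n n (\<lambda>(i, j). (p - r * x i) / x i * (q * x i) ^ j + (x i - p) / x i * x i ^ j))"
    unfolding det_vandermonde[symmetric] by (rule sum_Pow_det_rows)
  also have "\<dots> = det (mat n n (\<lambda>(i, j). poly (P j) (x i)))"
    by (intro arg_cong[where f = det] eq_matI) (simp_all add: ev del: times_divide_eq_left)
  also have "\<dots> = (\<Prod>j<n. 1 - r * q ^ j) * vand n x"
    using det_poly_basis[of n P x] deg lc by (simp add: det_vandermonde)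
  finally show ?thesis .
qed

section \<open>Families of non-intersecting paths\<close>

definition qdist :: "'a::field \<Rightarrow> int \<Rightarrow> int \<Rightarrow> 'a" where
  "qdist q i j = q powi (max i j) - q powi (min i j)"

lemma qdist_commute: "qdist q i j = qdist q j i"
  by (simp add: qdist_def max.commute min.commute)

definition qvand :: "'a::field \<Rightarrow> int set \<Rightarrow> 'a" where
  "qvand q S = (\<Prod>(i, j)\<in>{(i, j). i \<in> S \<and> j \<in> S \<and> i < j}. q powi j - q powi i)"

definition cross :: "'a::field \<Rightarrow> int set \<Rightarrow> int set \<Rightarrow> 'a" where
  "cross q S T = (\<Prod>i\<in>S. \<Prod>j\<in>T. qdist q i j)"

lemma finite_ordered_pairs:
  "finite S \<Longrightarrow> finite {(i, j). i \<in> S \<and> j \<in> S \<and> i < (j :: int)}"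
  by (rule finite_subset[of _ "S \<times> S"]) auto

lemma qvand_empty [simp]: "qvand q {} = 1"
  by (simp add: qvand_def)

lemma qvand_insert:
  assumes "finite S" "x \<notin> S"
  shows "qvand q (insert x S) = qvand q S * (\<Prod>s\<in>S. qdist q x s)"
proof -
  let ?P = "{(i, j). i \<in> S \<and> j \<in> S \<and> i < j}"
  let ?N = "(\<lambda>s. (min x s, max x s)) ` S"
  have inj: "inj_on (\<lambda>s. (min x s, max x s)) S"
    by (auto simp: inj_on_def min_def max_def split: if_splits)
  have "{(i, j). i \<in> insert x S \<and> j \<in> insert x S \<and> i < j} = ?P \<union> ?N" (is "?L = _")
  proof (intro Set.set_eqI iffI)
    fix p assume "p \<in> ?L"
    then obtain i j where p: "p = (i, j)" "i < j" "i \<in> insert x S" "j \<in> insert x S" by auto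
    then consider "i = x" "j \<in> S" | "j = x" "i \<in> S" | "i \<in> S" "j \<in> S" by auto
    then show "p \<in> ?P \<union> ?N"
    proof cases
      case 1
      then have "p = (\<lambda>s. (min x s, max x s)) j" using p by simp
      then show ?thesis using 1 by blast
    next
      case 2
      then have "p = (\<lambda>s. (min x s, max x s)) i" using p by simp
      then show ?thesis using 2 by blast
    qed (use p in auto)
  next
    fix p assume "p \<in> ?P \<union> ?N"
    then show "p \<in> ?L" using assms(2) by (auto simp: min_def max_def order_less_le split: if_splits)
  qed
  moreover have "?P \<inter> ?N = {}" using assms(2) by (auto simp: min_def max_def split: if_splits)
  ultimately have "qvand q (insert x S) = qvand q S * (\<Prod>(i, j)\<in>?N. q powi j - q powi i)"
    unfolding qvand_def using finite_ordered_pairs[OF assms(1)] assms(1)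
    by (simp add: prod.union_disjoint)
  then show ?thesis
    by (simp add: prod.reindex[OF inj] qdist_def)
qed

lemma qvand_union:
  assumes "finite S" "finite T" "S \<inter> T = {}"
  shows "qvand q (S \<union> T) = qvand q S * qvand q T * cross q S T"
  using assms(1,3)
proof (induction S rule: finite_induct)
  case empty
  then show ?case by (simp add: cross_def)
next
  case (insert x S)
  have "qvand q (insert x S \<union> T) = qvand q (S \<union> T) * (\<Prod>s\<in>S \<union> T. qdist q x s)"
    using insert assms(2) by (simp add: qvand_insert)
  also have "(\<Prod>s\<in>S \<union> T. qdist q x s) = (\<Prod>s\<in>S. qdist q x s) * (\<Prod>s\<in>T. qdist q x s)"
    using insert assms(2) by (intro prod.union_disjoint) auto
  finally show ?case
    using insert by (simp add: qvand_insert cross_def)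
qed

text \<open>Each unordered pair is met twice, once from either end, and \<open>qdist\<close> is
  symmetric.\<close>

lemma prod_qdist_diff_self:
  assumes "finite S"
  shows "(\<Prod>u\<in>S. \<Prod>j\<in>S - {u}. qdist q u j) = (qvand q S)\<^sup>2"
  using assms
proof (induction S rule: finite_induct)
  case (insert x S)
  have "(\<Prod>j\<in>insert x S - {u}. qdist q u j) = qdist q x u * (\<Prod>j\<in>S - {u}. qdist q u j)"
    if "u \<in> S" for u
  proof -
    have "insert x S - {u} = insert x (S - {u})" using that insert by auto
    then show ?thesis using insert by (simp add: qdist_commute)
  qed
  then have "(\<Prod>u\<in>insert x S. \<Prod>j\<in>insert x S - {u}. qdist q u j)
      = (\<Prod>j\<in>S. qdist q x j) * ((\<Prod>j\<in>S. qdist q x j) * (\<Prod>u\<in>S. \<Prod>j\<in>S - {u}. qdist q u j))"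
    using insert by (simp add: prod.distrib)
  then show ?case
    using insert by (simp add: qvand_insert power2_eq_square algebra_simps)
qed simp

text \<open>Trades the Vandermonde product of a complement for that of the set itself, at the price
  of a factor that splits over the single elements of \<open>X\<close>. In that factor, pairs inside
  \<open>X\<close> occur twice and pairs between \<open>X\<close> and its complement once.\<close>

lemma qvand_complement:
  assumes "finite I" "X \<subseteq> I"
  shows "qvand q (I - X) * (\<Prod>u\<in>X. \<Prod>j\<in>I - {u}. qdist q u j) = qvand q I * qvand q X"
proof -
  have fin: "finite X" "finite (I - X)" using assms finite_subset by auto
  have "(\<Prod>j\<in>I - {u}. qdist q u j)
      = (\<Prod>j\<in>X - {u}. qdist q u j) * (\<Prod>j\<in>I - X. qdist q u j)" if "u \<in> X" for u
  proof -
    have "I - {u} = (X - {u}) \<union> (I - X)" using that assms by auto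
    then show ?thesis using fin by (simp only:) (intro prod.union_disjoint; auto)
  qed
  then have "(\<Prod>u\<in>X. \<Prod>j\<in>I - {u}. qdist q u j) = (qvand q X)\<^sup>2 * cross q X (I - X)"
    by (simp add: prod.distrib prod_qdist_diff_self[OF fin(1), symmetric] cross_def)
  moreover have "qvand q I = qvand q X * qvand q (I - X) * cross q X (I - X)"
    using qvand_union[OF fin, of q] assms by (simp add: Un_absorb1)
  ultimately show ?thesis by (simp add: power2_eq_square)
qed

section \<open>One step of a family of holes\<close>

definition shift_up :: "int set \<Rightarrow> int \<Rightarrow> int" where
  "shift_up E d = (if d \<in> E then d + 1 else d)"

lemma shift_up_mono: "i < j \<Longrightarrow> shift_up E i \<le> shift_up E j"
  by (simp add: shift_up_def)

text \<open>A shift by at most one never reverses the order of two integers; it can only make them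
  collide, and a collision produces a zero factor.\<close>

lemma prod_pairs_shift_up:
  assumes "finite X"
  shows "(\<Prod>(i, j)\<in>{(i, j). i \<in> X \<and> j \<in> X \<and> i < j}. q powi (shift_up E j) - q powi (shift_up E i))
    = (if inj_on (shift_up E) X then qvand q (shift_up E ` X) else 0)"
proof (cases "inj_on (shift_up E) X")
  case True
  let ?P = "{(i, j). i \<in> X \<and> j \<in> X \<and> i < j}"
  have lt: "shift_up E i < shift_up E j" if "i \<in> X" "j \<in> X" "i < j" for i j
    using shift_up_mono[OF that(3), of E] inj_onD[OF True, of i j] that by (auto simp: order_less_le)
  have lt_iff: "shift_up E i < shift_up E j \<longleftrightarrow> i < j" if "i \<in> X" "j \<in> X" for i j
    using lt[OF that] lt[OF that(2,1)] by (cases i j rule: linorder_cases) auto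
  have "{(i, j). i \<in> shift_up E ` X \<and> j \<in> shift_up E ` X \<and> i < j} = map_prod (shift_up E) (shift_up E) ` ?P"
    using lt_iff by (auto simp: map_prod_def image_def)
  moreover have "inj_on (map_prod (shift_up E) (shift_up E)) ?P"
    using True by (auto simp: inj_on_def)
  ultimately show ?thesis
    using True by (simp add: qvand_def prod.reindex case_prod_unfold)
next
  case False
  then obtain i j where "i \<in> X" "j \<in> X" "i < j" "shift_up E i = shift_up E j"
    unfolding inj_on_def by (metis linorder_neqE)
  then have "\<exists>p\<in>{(i, j). i \<in> X \<and> j \<in> X \<and> i < j}. (case p of (i, j) \<Rightarrow> q powi (shift_up E j) - q powi (shift_up E i)) = 0"
    by (intro bexI[of _ "(i, j)"]) auto
  then show ?thesis using False finite_ordered_pairs[OF assms] by (simp add: prod_zero)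
qed

lemma prod_ordered_pairs_reindex:
  fixes e :: "nat \<Rightarrow> int"
  assumes "bij_betw e {..<n} X" "strict_mono_on {..<n} e"
  shows "(\<Prod>(i, j)\<in>{(i, j). i \<in> X \<and> j \<in> X \<and> i < j}. g i j) = (\<Prod>j<n. \<Prod>i<j. g (e i) (e j))"
proof -
  have lt_iff: "e i < e j \<longleftrightarrow> i < j" if "i < n" "j < n" for i j
    using assms(2) that by (simp add: strict_mono_on_less)
  let ?N = "{(i, j). i < n \<and> j < n \<and> i < j}"
  have X: "X = e ` {..<n}" using assms(1) by (simp add: bij_betw_def)
  have "{(i, j). i \<in> X \<and> j \<in> X \<and> i < j} = map_prod e e ` ?N"
    unfolding X using lt_iff by (auto simp: image_def)
  moreover have "inj_on (map_prod e e) ?N"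
    using assms(1) by (auto simp: inj_on_def bij_betw_def)
  ultimately have "(\<Prod>(i, j)\<in>{(i, j). i \<in> X \<and> j \<in> X \<and> i < j}. g i j)
      = (\<Prod>(i, j)\<in>?N. g (e i) (e j))"
    by (simp add: prod.reindex case_prod_unfold)
  also have "?N = (\<lambda>(j, i). (i, j)) ` (SIGMA j:{..<n}. {..<j})" by (auto simp: image_def)
  also have "(\<Prod>(i, j)\<in>\<dots>. g (e i) (e j)) = (\<Prod>(j, i)\<in>(SIGMA j:{..<n}. {..<j}). g (e i) (e j))"
    by (subst prod.reindex) (auto simp: inj_on_def case_prod_unfold)
  also have "\<dots> = (\<Prod>j<n. \<Prod>i<j. g (e i) (e j))"
    by (subst prod.Sigma) auto
  finally show ?thesis .
qed

text \<open>This is \<open>vand_shift_sum\<close> at the nodes \<open>q powi d\<close>, where moving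
  a hole up by one multiplies its node by q. The colliding choices of \<open>E\<close> may be added
  or dropped since their Vandermonde product is zero.\<close>

lemma qvand_shift_sum:
  assumes "q \<noteq> 0" "finite X"
  shows "(\<Sum>E | E \<subseteq> X \<and> inj_on (shift_up E) X.
      (\<Prod>d\<in>X. if d \<in> E then (p - r * q powi d) / q powi d else (q powi d - p) / q powi d)
      * qvand q (shift_up E ` X))
    = (\<Prod>j<card X. 1 - r * q ^ j) * qvand q X"
proof -
  define n where "n = card X"
  define e where "e i = sorted_list_of_set X ! i" for i
  have e: "bij_betw e {..<n} X" "strict_mono_on {..<n} e"
    using assms(2) sorted_wrt_nth_less[OF strict_sorted_list_of_set, of _ _ X]
    by (auto simp: n_def e_def[abs_def] strict_mono_on_def intro!: bij_betw_nth)
  have inj: "inj_on e {..<n}" and X: "X = e ` {..<n}" using e by (auto simp: bij_betw_def)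
  define w where "w E = (\<Prod>d\<in>X. if d \<in> E then (p - r * q powi d) / q powi d
    else (q powi d - p) / q powi d)" for E
  define v where "v E = (\<Prod>(i, j)\<in>{(i, j). i \<in> X \<and> j \<in> X \<and> i < j}.
    q powi (shift_up E j) - q powi (shift_up E i))" for E
  have mem: "e i \<in> e ` E \<longleftrightarrow> i \<in> E" if "E \<in> Pow {..<n}" "i < n" for E i
    using that inj by (auto simp: inj_on_def)
  have "(\<Sum>E | E \<subseteq> X \<and> inj_on (shift_up E) X. w E * qvand q (shift_up E ` X)) = (\<Sum>E\<in>Pow X. w E * v E)"
    unfolding v_def prod_pairs_shift_up[OF assms(2)] using assms(2)
    by (intro sum.mono_neutral_cong_left) auto
  also have "\<dots> = (\<Sum>E\<in>Pow {..<n}. w (e ` E) * v (e ` E))"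
    using bij_betw_Pow[OF e(1)] by (subst sum.reindex_bij_betw[symmetric]) auto
  also have "\<dots> = (\<Sum>E\<in>Pow {..<n}.
      (\<Prod>i<n. if i \<in> E then (p - r * q powi e i) / q powi e i else (q powi e i - p) / q powi e i)
      * vand n (\<lambda>i. if i \<in> E then q * q powi e i else q powi e i))"
  proof (intro sum.cong refl arg_cong2[where f = times])
    fix E assume E: "E \<in> Pow {..<n}"
    show "w (e ` E) = (\<Prod>i<n. if i \<in> E then (p - r * q powi e i) / q powi e i
        else (q powi e i - p) / q powi e i)"
      unfolding w_def X prod.reindex[OF inj] by (intro prod.cong) (simp_all add: mem[OF E])
    have shift_up: "q powi (shift_up (e ` E) (e i)) = (if i \<in> E then q * q powi e i else q powi e i)"
      if "i < n" for i
      using assms(1) by (simp add: shift_up_def mem[OF E that] power_int_add)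
    show "v (e ` E) = vand n (\<lambda>i. if i \<in> E then q * q powi e i else q powi e i)"
      unfolding v_def prod_ordered_pairs_reindex[OF e] vand_def
      by (intro prod.cong refl) (simp add: shift_up)
  qed
  also have "\<dots> = (\<Prod>j<n. 1 - r * q ^ j) * vand n (\<lambda>i. q powi e i)"
    using assms(1) by (intro vand_shift_sum) simp
  also have "vand n (\<lambda>i. q powi e i) = qvand q X"
    unfolding qvand_def prod_ordered_pairs_reindex[OF e] vand_def ..
  finally show ?thesis by (simp add: w_def n_def)
qed

text \<open>A left lozenge crossing the segment at height v has its top side at height
  \<open>v + 1\<close>. A hole there divides the weight of the completely crossed line by the weight
  of that lozenge.\<close>

definition hole_wt :: "'a::field \<Rightarrow> int set \<Rightarrow> 'a" where
  "hole_wt q V = (\<Prod>v\<in>V. q powi (- (v + 1)))"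

text \<open>
  Families of paths from \<open>U\<close> to \<open>X\<close> in \<open>k\<close> steps, each step moving every element by \<open>0\<close> or \<open>- 1\<close> (read backwards
  here: \<open>E\<close> is the set of end points of the steps \<open>- 1\<close>). Every line but the last one, \<open>X\<close>, contributes its weight, which
  makes path sums multiplicative under concatenation.
\<close>

primrec path_sum :: "'a::field \<Rightarrow> nat \<Rightarrow> int set \<Rightarrow> int set \<Rightarrow> 'a" where
  "path_sum q 0 U X = of_bool (U = X)"
| "path_sum q (Suc k) U X = (\<Sum>E | E \<subseteq> X \<and> inj_on (shift_up E) X.
     hole_wt q (shift_up E ` X) * path_sum q k U (shift_up E ` X))"

lemma path_sum_Suc_nonzeroE:
  assumes "path_sum q (Suc k) U X \<noteq> 0"
  obtains E where "E \<subseteq> X" "inj_on (shift_up E) X" "path_sum q k U (shift_up E ` X) \<noteq> 0"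
  using assms by (auto elim: sum.not_neutral_contains_not_neutral)

lemma shift_up_image_subset: "X \<subseteq> {l..h} \<Longrightarrow> shift_up E ` X \<subseteq> {l..h + 1}"
  by (auto simp: shift_up_def)

lemma path_sum_support_end:
  "path_sum q k U X \<noteq> 0 \<Longrightarrow> U \<subseteq> {l..h} \<Longrightarrow> X \<subseteq> {l - int k..h}"
proof (induction k arbitrary: X)
  case (Suc k)
  from Suc.prems(1) obtain E where "path_sum q k U (shift_up E ` X) \<noteq> 0" by (rule path_sum_Suc_nonzeroE)
  from Suc.IH[OF this Suc.prems(2)] show ?case by (fastforce simp: shift_up_def split: if_splits)
qed (simp split: if_splits)

lemma path_sum_card: "path_sum q k U X \<noteq> 0 \<Longrightarrow> card X = card U"
proof (induction k arbitrary: X)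
  case (Suc k)
  from Suc.prems(1) obtain E where "inj_on (shift_up E) X" "path_sum q k U (shift_up E ` X) \<noteq> 0"
    by (rule path_sum_Suc_nonzeroE)
  then show ?case using Suc.IH card_image by metis
qed (simp split: if_splits)

lemma sum_shift_up:
  assumes "finite X" "E \<subseteq> X" "inj_on (shift_up E) X"
  shows "\<Sum>(shift_up E ` X) = \<Sum>X + int (card E)"
proof -
  have "\<Sum>(shift_up E ` X) = (\<Sum>d\<in>X. d + of_bool (d \<in> E))"
    unfolding sum.reindex[OF assms(3)] by (intro sum.cong) (auto simp: shift_up_def)
  also have "\<dots> = \<Sum>X + int (card (X \<inter> E))" by (simp add: sum.distrib assms(1))
  finally show ?thesis using assms(2) by (simp add: Int_absorb1)
qed

lemma path_sum_sum_le: "path_sum q k U X \<noteq> 0 \<Longrightarrow> finite X \<Longrightarrow> \<Sum>X \<le> \<Sum>U"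
proof (induction k arbitrary: X)
  case (Suc k)
  from Suc.prems(1) obtain E where E: "E \<subseteq> X" "inj_on (shift_up E) X" "path_sum q k U (shift_up E ` X) \<noteq> 0"
    by (rule path_sum_Suc_nonzeroE)
  from Suc.IH[OF E(3)] Suc.prems(2) show ?case by (simp add: sum_shift_up E)
qed (simp split: if_splits)

text \<open>No step raises the sum of the positions, so a family that ends where it starts never
  moves. This value later fixes the constant in the closed formula.\<close>

lemma path_sum_self:
  assumes "finite U"
  shows "path_sum q k U U = hole_wt q U ^ k"
proof (induction k)
  case (Suc k)
  have id: "shift_up {} ` U = U" "inj_on (shift_up {}) U" by (auto simp: shift_up_def inj_on_def)
  have "path_sum q k U (shift_up E ` U) = 0" if "E \<subseteq> U" "inj_on (shift_up E) U" "E \<noteq> {}" for E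
  proof (rule ccontr)
    assume "path_sum q k U (shift_up E ` U) \<noteq> 0"
    from path_sum_sum_le[OF this] have "card E = 0" using sum_shift_up[OF assms that(1,2)] assms by simp
    then show False using that finite_subset[OF that(1) assms] by simp
  qed
  then have "path_sum q (Suc k) U U = (\<Sum>E\<in>{{}}. hole_wt q (shift_up E ` U) * path_sum q k U (shift_up E ` U))"
    unfolding path_sum.simps using assms id by (intro sum.mono_neutral_right) auto
  then show ?case using Suc id by simp
qed simp

text \<open>Splits the families at the line reached after k steps. The range for \<open>H\<close>
  suffices because, read backwards from \<open>X\<close>, positions never fall and rise by at most
  one per step.\<close>

lemma path_sum_add:
  assumes "X \<subseteq> {l..h}"
  shows "path_sum q (k + m) U X = (\<Sum>H\<in>Pow {l..h + int m}. path_sum q k U H * path_sum q m H X)"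
  using assms
proof (induction m arbitrary: X h)
  case 0
  have "(\<Sum>H\<in>Pow {l..h}. path_sum q k U H * path_sum q 0 H X) = (\<Sum>H\<in>{X}. path_sum q k U H * path_sum q 0 H X)"
    using 0 by (intro sum.mono_neutral_right) auto
  then show ?case by simp
next
  case (Suc m)
  let ?P = "{l..h + int (Suc m)}"
  have "path_sum q (k + Suc m) U X = (\<Sum>E | E \<subseteq> X \<and> inj_on (shift_up E) X.
      \<Sum>H\<in>Pow ?P. path_sum q k U H * (hole_wt q (shift_up E ` X) * path_sum q m H (shift_up E ` X)))"
    using Suc.IH[OF shift_up_image_subset[OF Suc.prems]]
    by (simp add: sum_distrib_left algebra_simps)
  also have "\<dots> = (\<Sum>H\<in>Pow ?P. path_sum q k U H * path_sum q (Suc m) H X)"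
    by (subst sum.swap) (simp add: sum_distrib_left)
  finally show ?case .
qed

text \<open>
  Reversing and reflecting a family of paths exchanges its two ends. The centre of the reflection is chosen
  such that passing from \<open>q\<close> to its inverse restores the weights.
\<close>

definition hrefl :: "int \<Rightarrow> int" where
  "hrefl v = - 2 - v"

lemma hrefl_hrefl [simp]: "hrefl (hrefl v) = v"
  by (simp add: hrefl_def)

lemma hrefl_image_image [simp]: "hrefl ` hrefl ` X = X"
  by (simp add: image_image)

lemma inj_hrefl [simp]: "inj_on hrefl X"
  by (auto simp: inj_on_def hrefl_def)

lemma hole_wt_hrefl: "hole_wt (inverse q) (hrefl ` V) = hole_wt q V"
proof -
  have "inverse q powi (- (hrefl v + 1)) = q powi (- (v + 1))" for v
    unfolding power_int_inverse power_int_minus[symmetric] by (simp add: hrefl_def)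
  then show ?thesis by (simp add: hole_wt_def prod.reindex)
qed

text \<open>The cardinality of this set is the entry of the one-step transfer matrix. It will also
  be the number of tilings of one column with \<open>Up\<close> heights \<open>V\<close> and
  \<open>Down\<close> heights \<open>X\<close>.\<close>

definition lifts :: "int set \<Rightarrow> int set \<Rightarrow> int set set" where
  "lifts V X = {E. E \<subseteq> X \<and> inj_on (shift_up E) X \<and> shift_up E ` X = V}"

lemma finite_lifts: "finite X \<Longrightarrow> finite (lifts V X)"
  by (rule finite_subset[of _ "Pow X"]) (auto simp: lifts_def)

lemma card_lifts_le:
  assumes "finite V"
  shows "card (lifts V X) \<le> card (lifts (hrefl ` X) (hrefl ` V))"
proof (rule card_inj_on_le)
  \<comment> \<open>A step from \<open>d + 1\<close> down to d, reversed and reflected, leads from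
    \<open>hrefl d\<close> down to \<open>hrefl (d + 1)\<close>, and it is again recorded by its
    lower end.\<close>
  let ?f = "\<lambda>E. (\<lambda>d. hrefl (d + 1)) ` E"
  show "inj_on ?f (lifts V X)"
    by (intro inj_onI) (simp add: inj_image_eq_iff inj_on_def hrefl_def)
  show "?f ` lifts V X \<subseteq> lifts (hrefl ` X) (hrefl ` V)"
  proof clarify
    fix E assume E: "E \<in> lifts V X"
    then have V: "V = shift_up E ` X" and EX: "E \<subseteq> X" and inj: "inj_on (shift_up E) X"
      by (auto simp: lifts_def)
    have mem: "hrefl (shift_up E d) \<in> ?f E \<longleftrightarrow> d \<in> E" if d: "d \<in> X" for d
    proof
      assume "hrefl (shift_up E d) \<in> ?f E"
      then obtain d' where d': "d' \<in> E" "shift_up E d = shift_up E d'" by (auto simp: hrefl_def shift_up_def)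
      with inj d EX have "d = d'" by (auto dest: inj_onD)
      with d' show "d \<in> E" by simp
    qed (auto simp: shift_up_def)
    have shift_up: "shift_up (?f E) (hrefl (shift_up E d)) = hrefl d" if "d \<in> X" for d
      unfolding shift_up_def[of "?f E"] mem[OF that] by (simp add: shift_up_def hrefl_def)
    show "?f E \<in> lifts (hrefl ` X) (hrefl ` V)"
      unfolding lifts_def mem_Collect_eq
    proof (intro conjI)
      show "?f E \<subseteq> hrefl ` V" using EX by (auto simp: V shift_up_def image_def) 
      show "inj_on (shift_up (?f E)) (hrefl ` V)"
        unfolding V by (auto intro!: inj_onI simp: shift_up dest!: injD[OF inj_hrefl])
      show "shift_up (?f E) ` hrefl ` V = hrefl ` X"
        unfolding V image_image using shift_up by (auto simp: image_def)
    qed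
  qed
qed (use assms in \<open>simp add: finite_lifts\<close>)

lemma card_lifts_hrefl:
  assumes "finite V" "finite X"
  shows "card (lifts (hrefl ` X) (hrefl ` V)) = card (lifts V X)"
  using card_lifts_le[of V X] card_lifts_le[of "hrefl ` X" "hrefl ` V"] assms by simp

lemma path_sum_Suc_lifts:
  assumes "X \<subseteq> {l..h}"
  shows "path_sum q (Suc k) U X = (\<Sum>V\<in>Pow {l..h + 1}. of_nat (card (lifts V X)) * (hole_wt q V * path_sum q k U V))"
proof -
  let ?S = "{E. E \<subseteq> X \<and> inj_on (shift_up E) X}"
  have finX: "finite X" using assms finite_subset by auto
  have fin: "finite ?S" by (rule finite_subset[of _ "Pow X"]) (use finX in auto)
  have lifts: "lifts V X = {E\<in>?S. shift_up E ` X = V}" for V by (auto simp: lifts_def)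
  have "path_sum q (Suc k) U X = (\<Sum>V\<in>Pow {l..h + 1}. \<Sum>E\<in>{E\<in>?S. shift_up E ` X = V}.
      hole_wt q (shift_up E ` X) * path_sum q k U (shift_up E ` X))"
    unfolding path_sum.simps using shift_up_image_subset[OF assms] fin
    by (subst sum.group) auto
  also have "\<dots> = (\<Sum>V\<in>Pow {l..h + 1}. of_nat (card (lifts V X)) * (hole_wt q V * path_sum q k U V))"
    unfolding lifts by (intro sum.cong refl) (simp add: sum_constant[symmetric] del: sum_constant)
  finally show ?thesis .
qed

text \<open>\<open>path_sum\<close> weighs the first line and omits the last one. Multiplying by the
  weight of the omitted line makes the expression symmetric under reversal.\<close>

lemma path_sum_hrefl:
  assumes "U \<subseteq> {l..h}" "X \<subseteq> {l..h}"
  shows "hole_wt q X * path_sum q k U X = hole_wt q U * path_sum (inverse q) k (hrefl ` X) (hrefl ` U)"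
  using assms
proof (induction k arbitrary: U l h)
  case 0
  have "hrefl ` X = hrefl ` U \<longleftrightarrow> X = U" by (metis hrefl_image_image)
  then show ?case by auto
next
  case (Suc k)
  have fin: "finite U" "finite X" using Suc.prems finite_subset by auto
  have X: "X \<subseteq> {l - 1..h}" using Suc.prems by auto
  \<comment> \<open>The first step has to be split off, since reversal makes it the last step, which
    is the one that the recursion of \<open>path_sum\<close> unfolds.\<close>
  have one: "path_sum q 1 U H = hole_wt q U * of_nat (card (lifts U H))" if H: "H \<subseteq> {l - 1..h + int k}" for H
  proof -
    have UP: "U \<in> Pow {l - 1..h + int k + 1}" using Suc.prems by auto
    have "path_sum q 1 U H = (\<Sum>V\<in>{U}. of_nat (card (lifts V H)) * (hole_wt q V * path_sum q 0 U V))"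
      unfolding One_nat_def path_sum_Suc_lifts[OF H] using UP by (intro sum.mono_neutral_right) auto
    then show ?thesis by simp
  qed
  have "path_sum q (Suc k) U X = (\<Sum>H\<in>Pow {l - 1..h + int k}. path_sum q 1 U H * path_sum q k H X)"
    using path_sum_add[OF X, of q 1 k U] by simp
  also have "\<dots> = (\<Sum>H\<in>Pow {l - 1..h + int k}. hole_wt q U * of_nat (card (lifts U H)) * path_sum q k H X)"
    by (intro sum.cong refl) (simp only: one Pow_iff)
  finally have "hole_wt q X * path_sum q (Suc k) U X
      = hole_wt q U * (\<Sum>H\<in>Pow {l - 1..h + int k}. of_nat (card (lifts U H)) * (hole_wt q X * path_sum q k H X))"
    by (simp add: sum_distrib_left algebra_simps)
  also have "(\<Sum>H\<in>Pow {l - 1..h + int k}. of_nat (card (lifts U H)) * (hole_wt q X * path_sum q k H X))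
     = (\<Sum>H\<in>Pow {l - 1..h + int k}. of_nat (card (lifts (hrefl ` H) (hrefl ` U)))
         * (hole_wt (inverse q) (hrefl ` H) * path_sum (inverse q) k (hrefl ` X) (hrefl ` H)))"
  proof (intro sum.cong refl)
    fix H assume H: "H \<in> Pow {l - 1..h + int k}"
    then have "finite H" using finite_subset by auto
    moreover have "X \<subseteq> {l - 1..h + int k}" using Suc.prems by auto
    ultimately show "of_nat (card (lifts U H)) * (hole_wt q X * path_sum q k H X)
        = of_nat (card (lifts (hrefl ` H) (hrefl ` U)))
         * (hole_wt (inverse q) (hrefl ` H) * path_sum (inverse q) k (hrefl ` X) (hrefl ` H))"
      using Suc.IH[of H "l - 1" "h + int k"] H fin by (simp add: card_lifts_hrefl hole_wt_hrefl)
  qed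
  also have "\<dots> = (\<Sum>V\<in>Pow {hrefl (h + int k)..hrefl (l - 1)}. of_nat (card (lifts V (hrefl ` U)))
         * (hole_wt (inverse q) V * path_sum (inverse q) k (hrefl ` X) V))"
  proof -
    have "bij_betw hrefl {l - 1..h + int k} {hrefl (h + int k)..hrefl (l - 1)}"
      by (intro bij_betwI[of _ _ _ hrefl]) (auto simp: hrefl_def)
    from bij_betw_Pow[OF this] show ?thesis by (subst sum.reindex_bij_betw[symmetric]) auto
  qed
  also have "\<dots> = path_sum (inverse q) (Suc k) (hrefl ` X) (hrefl ` U)"
  proof -
    have "hrefl ` U \<subseteq> {hrefl (h + int k)..hrefl l}" using Suc.prems by (auto simp: hrefl_def)
    moreover have "hrefl (l - 1) = hrefl l + 1" by (simp add: hrefl_def)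
    ultimately show ?thesis by (simp only: path_sum_Suc_lifts)
  qed
  finally show ?case .
qed

section \<open>Path families between intervals\<close>

locale generic_q =
  fixes q :: "'a::field"
  assumes q_nonzero: "q \<noteq> 0"
    and q_power_neq_1: "n > 0 \<Longrightarrow> q ^ n \<noteq> 1"
begin

lemma generic_q_inverse: "generic_q (inverse q)"
  by unfold_locales (auto simp: q_nonzero q_power_neq_1 power_inverse)

lemma powi_less_neq:
  assumes "i < j"
  shows "q powi i \<noteq> q powi j"
proof
  assume "q powi i = q powi j"
  then have "q powi (j - i) = 1" using q_nonzero by (simp add: power_int_diff)
  then have "q ^ nat (j - i) = 1" using assms by (simp add: power_int_def)
  then show False using q_power_neq_1[of "nat (j - i)"] assms by simp
qed

lemma qdist_nonzero: "i \<noteq> j \<Longrightarrow> qdist q i j \<noteq> 0"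
  using powi_less_neq[of "min i j" "max i j"] by (auto simp: qdist_def min_def max_def)

lemma qvand_nonzero: "finite S \<Longrightarrow> qvand q S \<noteq> 0"
  unfolding qvand_def using powi_less_neq
  by (subst prod_zero_iff) (use finite_ordered_pairs in \<open>auto, force+\<close>)

lemma prod_qdist_nonzero: "finite I \<Longrightarrow> (\<Prod>j\<in>I - {u}. qdist q u j) \<noteq> 0"
  by (auto simp: qdist_nonzero)

lemma hole_wt_nonzero: "hole_wt q V \<noteq> 0"
  by (cases "finite V") (auto simp: hole_wt_def q_nonzero)

lemma prod_qdist_extend_below:
  assumes "d \<in> {l..<h}"
  shows "(\<Prod>j\<in>{l - 1..<h} - {d}. qdist q d j)
    = (q powi d - q powi (l - 1)) * (\<Prod>j\<in>{l..<h} - {d}. qdist q d j)"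
proof -
  have "{l - 1..<h} - {d} = insert (l - 1) ({l..<h} - {d})" using assms by auto
  then show ?thesis using assms by (simp add: qdist_def max_def min_def)
qed

text \<open>Translation by one carries the factors at d inside \<open>{l - 1..<h - 1}\<close> to
  those at \<open>d + 1\<close> inside \<open>{l..<h}\<close> and scales each of the
  \<open>h - l - 1\<close> factors by q. Only the factor of the end point \<open>h - 1\<close> is
  left over.\<close>

lemma prod_qdist_extend_above:
  assumes "d + 1 \<in> {l..<h}"
  shows "q powi (h - l - 1) * (\<Prod>j\<in>{l - 1..<h} - {d}. qdist q d j)
    = (q powi (h - 1) - q powi d) * (\<Prod>j\<in>{l..<h} - {d + 1}. qdist q (d + 1) j)"
proof -
  have shift: "qdist q (d + 1) (j + 1) = q * qdist q d j" for j
    using q_nonzero by (auto simp: qdist_def max_def min_def power_int_add algebra_simps)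
  have img: "{l..<h} - {d + 1} = (\<lambda>j. j + 1) ` ({l - 1..<h - 1} - {d})"
  proof (intro Set.set_eqI iffI)
    fix j assume "j \<in> {l..<h} - {d + 1}"
    then show "j \<in> (\<lambda>j. j + 1) ` ({l - 1..<h - 1} - {d})"
      by (intro image_eqI[of _ _ "j - 1"]) auto
  qed auto
  have "card ({l - 1..<h - 1} - {d}) = nat (h - l - 1)"
    using assms by (subst card_Diff_singleton) auto
  then have "(\<Prod>j\<in>{l..<h} - {d + 1}. qdist q (d + 1) j)
      = q ^ nat (h - l - 1) * (\<Prod>j\<in>{l - 1..<h - 1} - {d}. qdist q d j)"
    unfolding img by (subst prod.reindex) (auto simp: inj_on_def shift prod.distrib)
  also have "q ^ nat (h - l - 1) = q powi (h - l - 1)"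
    using assms by (simp add: power_int_def)
  finally have *: "(\<Prod>j\<in>{l..<h} - {d + 1}. qdist q (d + 1) j)
      = q powi (h - l - 1) * (\<Prod>j\<in>{l - 1..<h - 1} - {d}. qdist q d j)" .
  have "{l - 1..<h} - {d} = insert (h - 1) ({l - 1..<h - 1} - {d})" using assms by auto
  then have "(\<Prod>j\<in>{l - 1..<h} - {d}. qdist q d j)
      = (q powi (h - 1) - q powi d) * (\<Prod>j\<in>{l - 1..<h - 1} - {d}. qdist q d j)"
    using assms by (simp add: qdist_def max_def min_def)
  then show ?thesis unfolding * by simp
qed

text \<open>The coefficients on the right vanish exactly when the shift leaves the interval.\<close>

lemma hole_wt_qvand_complement_shift_up:
  assumes X: "X \<subseteq> {l - 1..<h}" and E: "E \<subseteq> X" and inj: "inj_on (shift_up E) X"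
  shows "(if shift_up E ` X \<subseteq> {l..<h} then hole_wt q (shift_up E ` X) * qvand q ({l..<h} - shift_up E ` X) else 0)
    = qvand q {l..<h} / (q ^ card X * (\<Prod>d\<in>X. \<Prod>j\<in>{l - 1..<h} - {d}. qdist q d j))
      * ((\<Prod>d\<in>X. if d \<in> E then (q powi (l - 1) - q powi (l - h) * q powi d) / q powi d
                     else (q powi d - q powi (l - 1)) / q powi d)
        * qvand q (shift_up E ` X))"
proof -
  define \<phi> where "\<phi> u = (\<Prod>j\<in>{l..<h} - {u}. qdist q u j)" for u
  define \<psi> where "\<psi> u = (\<Prod>j\<in>{l - 1..<h} - {u}. qdist q u j)" for u
  define w where "w d = (if d \<in> E then (q powi (l - 1) - q powi (l - h) * q powi d) / q powi d
                     else (q powi d - q powi (l - 1)) / q powi d)" for d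
  have nz: "\<phi> u \<noteq> 0" "\<psi> u \<noteq> 0" for u
    unfolding \<phi>_def \<psi>_def by (simp_all add: prod_qdist_nonzero del: prod_zero_iff)
  show ?thesis
  proof (cases "shift_up E ` X \<subseteq> {l..<h}")
    case True
    \<comment> \<open>After \<open>qvand_complement\<close> the claim splits over single holes.
      \<open>\<phi>\<close> and \<open>\<psi>\<close> are the one-element factors in the interval
      before and after it grows by one at its lower end.\<close>
    have step: "q powi (- (shift_up E d + 1)) / \<phi> (shift_up E d) = w d / (q * \<psi> d)" if d: "d \<in> X" for d
    proof (cases "d \<in> E")
      case False
      then have 1: "\<psi> d = (q powi d - q powi (l - 1)) * \<phi> d"
        unfolding \<phi>_def \<psi>_def using True d by (intro prod_qdist_extend_below) (force simp: shift_up_def)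
      have shift_up: "shift_up E d = d" and w: "w d = (q powi d - q powi (l - 1)) / q powi d"
        using False by (simp_all add: shift_up_def w_def)
      have 2: "q powi (- (d + 1)) = 1 / (q powi d * q)"
        using q_nonzero by (subst power_int_minus_divide, subst power_int_add_1) simp_all
      have "q powi d - q powi (l - 1) \<noteq> 0" using 1 nz[of d] by auto
      then show ?thesis unfolding shift_up w 1 2 using nz[of d] q_nonzero by simp
    next
      case dE: True
      then have 1: "q powi (h - l - 1) * \<psi> d = (q powi (h - 1) - q powi d) * \<phi> (d + 1)"
        unfolding \<phi>_def \<psi>_def using True d by (intro prod_qdist_extend_above) (force simp: shift_up_def)
      have shift_up: "shift_up E d = d + 1" and w: "w d = (q powi (l - 1) - q powi (l - h) * q powi d) / q powi d"
        using dE by (simp_all add: shift_up_def w_def)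
      have 2: "q powi (- (d + 1 + 1)) = 1 / (q powi d * q * q)"
        using q_nonzero
        by (subst power_int_minus_divide, subst power_int_add_1, simp, subst power_int_add_1) simp_all
      have "q powi (l - 1) - q powi (l - h) * q powi d
          = q powi (l - h) * (q powi (h - 1) - q powi d)"
        using q_nonzero by (simp add: algebra_simps power_int_add[symmetric])
      moreover have "q powi (l - h) * q * q powi (h - l - 1) = 1"
        using q_nonzero power_int_add[of q "l - h + 1" "h - l - 1"] by (simp add: power_int_add)
      ultimately have "(q powi (l - 1) - q powi (l - h) * q powi d) * \<phi> (d + 1) * q = \<psi> d"
        using 1 by (metis (no_types, lifting) mult.assoc mult.commute mult_1)
      then show ?thesis
        unfolding shift_up w 2 using nz[of d] nz[of "d + 1"] q_nonzero by (simp add: field_simps)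
    qed
    have "qvand q ({l..<h} - shift_up E ` X) * (\<Prod>u\<in>shift_up E ` X. \<phi> u) = qvand q {l..<h} * qvand q (shift_up E ` X)"
      unfolding \<phi>_def using True by (intro qvand_complement) auto
    moreover have "(\<Prod>u\<in>shift_up E ` X. \<phi> u) = (\<Prod>d\<in>X. \<phi> (shift_up E d))"
      by (simp only: prod.reindex[OF inj] o_def)
    ultimately have "qvand q ({l..<h} - shift_up E ` X)
        = qvand q {l..<h} * qvand q (shift_up E ` X) / (\<Prod>d\<in>X. \<phi> (shift_up E d))"
      using nz finite_subset[OF X] by (simp add: field_simps)
    moreover have "hole_wt q (shift_up E ` X) = (\<Prod>d\<in>X. q powi (- (shift_up E d + 1)))"
      unfolding hole_wt_def by (simp only: prod.reindex[OF inj] o_def)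
    ultimately have "hole_wt q (shift_up E ` X) * qvand q ({l..<h} - shift_up E ` X)
        = qvand q {l..<h} * qvand q (shift_up E ` X) * (\<Prod>d\<in>X. q powi (- (shift_up E d + 1)) / \<phi> (shift_up E d))"
      by (simp add: prod_dividef)
    also have "(\<Prod>d\<in>X. q powi (- (shift_up E d + 1)) / \<phi> (shift_up E d)) = (\<Prod>d\<in>X. w d) / (q ^ card X * (\<Prod>d\<in>X. \<psi> d))"
    proof -
      have "(\<Prod>d\<in>X. q powi (- (shift_up E d + 1)) / \<phi> (shift_up E d)) = (\<Prod>d\<in>X. w d / (q * \<psi> d))"
        by (intro prod.cong refl step)
      then show ?thesis by (simp add: prod_dividef prod.distrib)
    qed
    finally show ?thesis using True by (simp add: w_def \<psi>_def)
  next
    case False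
    \<comment> \<open>The interval can be left in two ways only: \<open>h - 1\<close> moves up or
      \<open>l - 1\<close> stays. The parameters p = \<open>q powi (l - 1)\<close> and r =
      \<open>q powi (l - h)\<close> are the ones that annihilate both coefficients.\<close>
    then obtain d where d: "d \<in> X" "shift_up E d \<notin> {l..<h}" by blast
    have "w d = 0"
    proof (cases "d \<in> E")
      case True
      then have "d = h - 1" using d X by (auto simp: shift_up_def)
      then have "q powi (l - h) * q powi d = q powi (l - 1)"
        using q_nonzero by (simp add: power_int_add[symmetric])
      then show ?thesis by (simp add: w_def True)
    next
      case notE: False
      then have "d = l - 1" using d X by (auto simp: shift_up_def)
      then show ?thesis using notE by (simp add: w_def)
    qed
    then have "(\<Prod>d\<in>X. w d) = 0" using d finite_subset[OF X] by (auto intro: prod_zero)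
    then show ?thesis using False by (simp add: w_def)
  qed
qed

text \<open>Induction on the number of steps. Once complements are traded for holes, one step is an
  instance of \<open>qvand_shift_sum\<close>, and its value has the same shape in the interval
  enlarged below. Only independence of the constant from \<open>X\<close> matters, so it stays
  existential.\<close>

lemma path_sum_from_interval_aux:
  "\<exists>C. \<forall>X. finite X \<longrightarrow> card X = c \<longrightarrow> path_sum q k {s..<s + int c} X
    = (if X \<subseteq> {s - int k..<s + int c} then C * qvand q ({s - int k..<s + int c} - X) else 0)"
proof (induction k)
  case 0
  have "X = {s..<s + int c}" if "X \<subseteq> {s..<s + int c}" "card X = c" for X
    using that by (intro card_subset_eq) auto
  then show ?case by (intro exI[of _ 1]) auto
next
  case (Suc k)
  define l where "l = s - int k"
  define h where "h = s + int c"
  have l1: "s - int (Suc k) = l - 1" by (simp add: l_def)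
  from Suc obtain C where C: "\<And>X. finite X \<Longrightarrow> card X = c \<Longrightarrow> path_sum q k {s..<h} X
      = (if X \<subseteq> {l..<h} then C * qvand q ({l..<h} - X) else 0)"
    unfolding l_def h_def by blast
  \<comment> \<open>The product over j comes from the eigenvalues of the row operator,
    \<open>q ^ c\<close> collects one factor q per hole, and the two Vandermonde products record the
    change of the interval.\<close>
  define K where "K = C * qvand q {l..<h} * (\<Prod>j<c. 1 - q powi (l - h) * q ^ j)
    / (q ^ c * qvand q {l - 1..<h})"
  have "path_sum q (Suc k) {s..<h} X = (if X \<subseteq> {l - 1..<h} then K * qvand q ({l - 1..<h} - X) else 0)"
    if fin: "finite X" and card: "card X = c" for X
  proof -
    have CE: "path_sum q k {s..<h} (shift_up E ` X)
      = (if shift_up E ` X \<subseteq> {l..<h} then C * qvand q ({l..<h} - shift_up E ` X) else 0)"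
      if "inj_on (shift_up E) X" for E
      using C[of "shift_up E ` X"] fin card card_image[OF that] by simp
    show ?thesis
    proof (cases "X \<subseteq> {l - 1..<h}")
      case True
      define \<Psi> where "\<Psi> = (\<Prod>d\<in>X. \<Prod>j\<in>{l - 1..<h} - {d}. qdist q d j)"
      have \<Psi>: "\<Psi> \<noteq> 0"
        unfolding \<Psi>_def prod_zero_iff[OF fin] using prod_qdist_nonzero[of "{l - 1..<h}"] by blast
      define w where "w E = (\<Prod>d\<in>X. if d \<in> E then (q powi (l - 1) - q powi (l - h) * q powi d) / q powi d
                     else (q powi d - q powi (l - 1)) / q powi d)" for E
      have "path_sum q (Suc k) {s..<h} X = (\<Sum>E | E \<subseteq> X \<and> inj_on (shift_up E) X.
          C * (if shift_up E ` X \<subseteq> {l..<h} then hole_wt q (shift_up E ` X) * qvand q ({l..<h} - shift_up E ` X) else 0))"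
        unfolding path_sum.simps by (intro sum.cong refl) (auto simp: CE)
      also have "\<dots> = (\<Sum>E | E \<subseteq> X \<and> inj_on (shift_up E) X.
          C * (qvand q {l..<h} / (q ^ c * \<Psi>) * (w E * qvand q (shift_up E ` X))))"
        using hole_wt_qvand_complement_shift_up[OF True]
        by (intro sum.cong refl) (simp add: card w_def \<Psi>_def)
      also have "\<dots> = C * qvand q {l..<h} / (q ^ c * \<Psi>)
          * (\<Sum>E | E \<subseteq> X \<and> inj_on (shift_up E) X. w E * qvand q (shift_up E ` X))"
        by (simp add: sum_distrib_left algebra_simps)
      also have "\<dots> = C * qvand q {l..<h} / (q ^ c * \<Psi>)
          * ((\<Prod>j<c. 1 - q powi (l - h) * q ^ j) * qvand q X)"
        using qvand_shift_sum[OF q_nonzero fin] by (simp add: w_def card)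
      also have "\<dots> = K * qvand q ({l - 1..<h} - X)"
      proof -
        have "qvand q ({l - 1..<h} - X) * \<Psi> = qvand q {l - 1..<h} * qvand q X"
          unfolding \<Psi>_def using True by (intro qvand_complement) auto
        then have "qvand q X = qvand q ({l - 1..<h} - X) * \<Psi> / qvand q {l - 1..<h}"
          using qvand_nonzero[of "{l - 1..<h}"] by (simp add: field_simps)
        then show ?thesis using \<Psi> by (simp add: K_def)
      qed
      finally show ?thesis using True by simp
    next
      case False
      then obtain d where "d \<in> X" "d \<notin> {l - 1..<h}" by blast
      then have "\<not> shift_up E ` X \<subseteq> {l..<h}" for E by (fastforce simp: shift_up_def)
      then show ?thesis using False by (simp add: CE)
    qed
  qed
  then show ?case unfolding l1 h_def by blast
qed

text \<open>The constant is determined by \<open>X = {s..<s + int c}\<close>, which is reached by a single family.\<close>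

theorem path_sum_from_interval:
  assumes "finite X" "card X = c" "X \<subseteq> {s - int k..<s + int c}"
  shows "path_sum q k {s..<s + int c} X = hole_wt q {s..<s + int c} ^ k
    * qvand q ({s - int k..<s + int c} - X) / qvand q {s - int k..<s}"
proof -
  from path_sum_from_interval_aux[of c k s] obtain C where
    C: "\<And>X. finite X \<Longrightarrow> card X = c \<Longrightarrow> X \<subseteq> {s - int k..<s + int c} \<Longrightarrow>
      path_sum q k {s..<s + int c} X = C * qvand q ({s - int k..<s + int c} - X)"
    by fastforce
  have "hole_wt q {s..<s + int c} ^ k = C * qvand q ({s - int k..<s + int c} - {s..<s + int c})"
    using C[of "{s..<s + int c}"] path_sum_self[of "{s..<s + int c}" q k] by simp
  also have "{s - int k..<s + int c} - {s..<s + int c} = {s - int k..<s}" by auto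
  finally have "C = hole_wt q {s..<s + int c} ^ k / qvand q {s - int k..<s}"
    using qvand_nonzero[of "{s - int k..<s}"] by (simp add: field_simps)
  then show ?thesis using C[OF assms] by simp
qed

text \<open>The reflected powers of \<open>inverse q\<close> are the original powers of q times
  \<open>q\<^sup>2\<close>, but their order is reversed. So each pair contributes the factor
  \<open>- (q\<^sup>2)\<close>.\<close>

lemma qvand_hrefl:
  assumes "finite S"
  shows "qvand (inverse q) (hrefl ` S) = (- (q\<^sup>2)) ^ (card S choose 2) * qvand q S"
  using assms
proof (induction S rule: finite_induct)
  case (insert x S)
  have "inverse q powi hrefl i = q\<^sup>2 * q powi i" for i
    unfolding power_int_inverse power_int_minus[symmetric]
    using q_nonzero by (simp add: hrefl_def power_int_add)
  then have "qdist (inverse q) (hrefl x) (hrefl s) = - (q\<^sup>2) * qdist q x s" for s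
    by (auto simp: qdist_def hrefl_def max_def min_def algebra_simps)
  moreover have "hrefl x \<notin> hrefl ` S"
    using insert by (metis hrefl_hrefl image_iff)
  moreover have "Suc n choose 2 = (n choose 2) + n" for n
    by (simp add: numeral_2_eq_2)
  ultimately show ?case
    using insert by (simp add: qvand_insert prod.reindex prod.distrib power_add)
      (simp add: mult_ac flip: prod_constant prod.distrib)
qed (simp add: numeral_2_eq_2)

text \<open>Reversal and reflection reduce this to \<open>path_sum_from_interval\<close> for
  \<open>inverse q\<close>. The factors from \<open>qvand_hrefl\<close> cancel because the
  complement of \<open>H\<close> and the interval in the denominator both have k elements.\<close>

theorem path_sum_to_interval:
  assumes "finite H" "card H = c" "H \<subseteq> {e..<e + int c + int k}"
  shows "path_sum q k H {e..<e + int c}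
    = hole_wt q H * hole_wt q {e..<e + int c} ^ k / hole_wt q {e..<e + int c}
      * qvand q ({e..<e + int c + int k} - H) / qvand q {e + int c..<e + int c + int k}"
proof -
  interpret inv: generic_q "inverse q" by (rule generic_q_inverse)
  define s where "s = - 1 - e - int c"
  let ?E = "{e..<e + int c}"
  have img: "hrefl ` {i..<j} = {- 1 - j..<- 1 - i}" for i j
  proof (intro Set.set_eqI iffI)
    fix v assume "v \<in> {- 1 - j..<- 1 - i}"
    then show "v \<in> hrefl ` {i..<j}" by (intro image_eqI[of _ _ "hrefl v"]) (auto simp: hrefl_def)
  qed (auto simp: hrefl_def)
  have E: "hrefl ` ?E = {s..<s + int c}"
    and I: "hrefl ` {e..<e + int c + int k} = {s - int k..<s + int c}"
    and J: "hrefl ` {e + int c..<e + int c + int k} = {s - int k..<s}"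
    unfolding img s_def by (simp_all add: algebra_simps)
  have cD: "card ({e..<e + int c + int k} - H) = k"
    using assms by (simp add: card_Diff_subset)
  have D: "{s - int k..<s + int c} - hrefl ` H = hrefl ` ({e..<e + int c + int k} - H)"
    unfolding I[symmetric] by (rule image_set_diff[symmetric]) simp
  have sub: "H \<subseteq> {e..e + int c + int k}" "?E \<subseteq> {e..e + int c + int k}" using assms(3) by auto
  have "hole_wt q ?E * path_sum q k H ?E = hole_wt q H * path_sum (inverse q) k {s..<s + int c} (hrefl ` H)"
    using path_sum_hrefl[OF sub, of q k] by (simp only: E)
  also have "path_sum (inverse q) k {s..<s + int c} (hrefl ` H) = hole_wt q ?E ^ k
      * qvand (inverse q) (hrefl ` ({e..<e + int c + int k} - H))
      / qvand (inverse q) (hrefl ` {e + int c..<e + int c + int k})"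
    unfolding D[symmetric] J hole_wt_hrefl[symmetric, of q] E using assms I
    by (intro inv.path_sum_from_interval) (auto simp: card_image)
  also have "\<dots> = hole_wt q ?E ^ k * qvand q ({e..<e + int c + int k} - H)
      / qvand q {e + int c..<e + int c + int k}"
    using assms(1) q_nonzero by (simp add: qvand_hrefl cD)
  finally show ?thesis using hole_wt_nonzero[of ?E] qvand_nonzero by (simp add: field_simps)
qed

text \<open>On both sides, pairs inside one of the three sets occur twice and pairs between
  different sets once.\<close>

lemma qvand_triple:
  assumes "finite T" "finite Y" "finite Z" "T \<inter> Y = {}" "T \<inter> Z = {}" "Y \<inter> Z = {}"
  shows "qvand q (T \<union> Y) * qvand q (T \<union> Z) * qvand q (Y \<union> Z)
    = qvand q (T \<union> (Y \<union> Z)) * qvand q T * qvand q Y * qvand q Z"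
proof -
  have "cross q T (Y \<union> Z) = cross q T Y * cross q T Z"
    using assms by (simp add: cross_def prod.union_disjoint prod.distrib)
  moreover have "T \<inter> (Y \<union> Z) = {}" using assms by auto
  ultimately show ?thesis using assms by (simp add: qvand_union)
qed

text \<open>\<open>U\<^sub>0\<close> and \<open>E\<^sub>0\<close> are the NW and SE sides. On the
  cut line, \<open>A\<close> and \<open>B\<close> are the sides of the removed triangles, where
  paths stop, and \<open>H\<close> is where the other paths go on. \<open>U\<^sub>1\<close>,
  \<open>E\<^sub>1\<close> and the new step numbers are chosen such that the complements of
  \<open>H\<close> in the reachable intervals become
  \<open>T \<union> (Y \<union> (A \<union> B))\<close> and \<open>T\<close>.\<close>

lemma two_gap_sum_eq_path_sum:
  fixes a b x y z t :: nat
  defines "U\<^sub>0 \<equiv> {int (y + t)..<int (y + t) + int (z + a + b)}"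
    and "U\<^sub>1 \<equiv> {int (y + a + b + t)..<int (y + a + b + t) + int z}"
    and "A \<equiv> {0..<int a}" and "B \<equiv> {int (a + y + z)..<int (a + y + z + b)}"
    and "E\<^sub>0 \<equiv> {0..<0 + int z}" and "E\<^sub>1 \<equiv> {int a..<int a + int z}"
    and "Y \<equiv> {- int x..<0} \<union> {int (y + z + a + b)..<int (y + z + a + b + t)}"
  shows "(\<Sum>H\<in>Pow {int a..<int (a + y + z)}. path_sum q (x + y + t) U\<^sub>0 (H \<union> A \<union> B) * path_sum q (y + a + b) H E\<^sub>0)
    = hole_wt q U\<^sub>0 ^ (x + y + t) * hole_wt q E\<^sub>0 ^ (y + a + b) * hole_wt q E\<^sub>1
        / (hole_wt q E\<^sub>0 * hole_wt q E\<^sub>1 ^ y * hole_wt q U\<^sub>1 ^ (x + y + a + b + t))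
      * (qvand q Y * qvand q (A \<union> B) / qvand q (Y \<union> (A \<union> B)))
      * (qvand q {- int x..<int (y + a + b + t)} * qvand q {int a + int z..<int a + int z + int y}
        / (qvand q {- int x..<int (y + t)} * qvand q {int z..<int z + int (y + a + b)}))
      * path_sum q (x + y + a + b + t + y) U\<^sub>1 E\<^sub>1" (is "?lhs = ?\<rho> * _")
proof -
  let ?J = "{int a..<int (a + y + z)}"
  have summand: "path_sum q (x + y + t) U\<^sub>0 (H \<union> A \<union> B) * path_sum q (y + a + b) H E\<^sub>0
      = ?\<rho> * (path_sum q (x + y + a + b + t) U\<^sub>1 H * path_sum q y H E\<^sub>1)"
    if H: "H \<subseteq> ?J" for H
  proof (cases "card H = z")
    case True
    have fin: "finite H" using H finite_subset by auto
    define T where "T = ?J - H"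
    have sets: "{int (y + t) - int (x + y + t)..<int (y + t) + int (z + a + b)} - (H \<union> A \<union> B) = T \<union> Y"
      "{0..<0 + int z + int (y + a + b)} - H = T \<union> (A \<union> B)"
      "{int (y + a + b + t) - int (x + y + a + b + t)..<int (y + a + b + t) + int z} - H = T \<union> (Y \<union> (A \<union> B))"
      "{int a..<int a + int z + int y} - H = T"
      unfolding T_def Y_def A_def B_def using H by auto
    have low: "int (y + t) - int (x + y + t) = - int x"
      "int (y + a + b + t) - int (x + y + a + b + t) = - int x" by auto
    have finT: "finite T" "finite Y" "finite (A \<union> B)"
      unfolding T_def Y_def A_def B_def by auto
    have disj: "T \<inter> Y = {}" "T \<inter> (A \<union> B) = {}" "Y \<inter> (A \<union> B) = {}"
      unfolding T_def Y_def A_def B_def by auto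
    have card: "card (H \<union> A \<union> B) = z + a + b"
    proof -
      have "H \<inter> A = {}" "(H \<union> A) \<inter> B = {}" unfolding A_def B_def using H by auto
      then show ?thesis using fin True by (simp add: card_Un_disjoint A_def B_def)
    qed
    have 1: "path_sum q (x + y + t) U\<^sub>0 (H \<union> A \<union> B)
        = hole_wt q U\<^sub>0 ^ (x + y + t) * qvand q (T \<union> Y) / qvand q {- int x..<int (y + t)}"
      unfolding U\<^sub>0_def sets(1)[symmetric] low(1)[symmetric]
      using fin card H by (intro path_sum_from_interval) (auto simp: A_def B_def)
    have 2: "path_sum q (y + a + b) H E\<^sub>0 = hole_wt q H * hole_wt q E\<^sub>0 ^ (y + a + b) / hole_wt q E\<^sub>0
        * qvand q (T \<union> (A \<union> B)) / qvand q {int z..<int z + int (y + a + b)}"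
    proof -
      have "H \<subseteq> {0..<0 + int z + int (y + a + b)}" using H by auto
      from path_sum_to_interval[OF fin True this] show ?thesis
        unfolding E\<^sub>0_def sets(2) by simp
    qed
    have 3: "path_sum q (x + y + a + b + t) U\<^sub>1 H = hole_wt q U\<^sub>1 ^ (x + y + a + b + t)
        * qvand q (T \<union> (Y \<union> (A \<union> B))) / qvand q {- int x..<int (y + a + b + t)}"
      unfolding U\<^sub>1_def sets(3)[symmetric] low(2)[symmetric]
      using fin True H by (intro path_sum_from_interval) auto
    have 4: "path_sum q y H E\<^sub>1 = hole_wt q H * hole_wt q E\<^sub>1 ^ y / hole_wt q E\<^sub>1
        * qvand q T / qvand q {int a + int z..<int a + int z + int y}"
      unfolding E\<^sub>1_def sets(4)[symmetric]
      using fin True H by (intro path_sum_to_interval) auto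
    note nz = qvand_nonzero hole_wt_nonzero finT
    have 5: "qvand q (T \<union> Y) * qvand q (T \<union> (A \<union> B)) = qvand q Y * qvand q (A \<union> B) / qvand q (Y \<union> (A \<union> B))
        * (qvand q (T \<union> (Y \<union> (A \<union> B))) * qvand q T)"
      using qvand_triple[OF finT disj] nz by (simp add: field_simps)
    have "path_sum q (x + y + t) U\<^sub>0 (H \<union> A \<union> B) * path_sum q (y + a + b) H E\<^sub>0
        = hole_wt q U\<^sub>0 ^ (x + y + t) * (hole_wt q H * hole_wt q E\<^sub>0 ^ (y + a + b) / hole_wt q E\<^sub>0)
          / (qvand q {- int x..<int (y + t)} * qvand q {int z..<int z + int (y + a + b)})
          * (qvand q (T \<union> Y) * qvand q (T \<union> (A \<union> B)))"
      unfolding 1 2 by (simp add: mult_ac)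
    also have "\<dots> = ?\<rho> * (path_sum q (x + y + a + b + t) U\<^sub>1 H * path_sum q y H E\<^sub>1)"
      unfolding 5 unfolding 3 4 using nz by (simp add: field_simps)
    finally show ?thesis .
  next
    case False
    \<comment> \<open>Steps preserve the number of holes, so for any other cardinality of
      \<open>H\<close> both sides vanish.\<close>
    have "path_sum q m H {e..<e + int z} = 0" for m e
      using path_sum_card[of q m H "{e..<e + int z}"] False by auto
    then show ?thesis unfolding E\<^sub>0_def E\<^sub>1_def by (simp only: mult_zero_right)
  qed
  have "?lhs = ?\<rho> * (\<Sum>H\<in>Pow ?J. path_sum q (x + y + a + b + t) U\<^sub>1 H * path_sum q y H E\<^sub>1)"
    unfolding sum_distrib_left by (intro sum.cong refl summand) auto
  also have "(\<Sum>H\<in>Pow ?J. path_sum q (x + y + a + b + t) U\<^sub>1 H * path_sum q y H E\<^sub>1)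
      = path_sum q (x + y + a + b + t + y) U\<^sub>1 E\<^sub>1"
  proof -
    have J: "?J = {int a..(int a + int z - 1) + int y}" by auto
    show ?thesis unfolding J by (rule path_sum_add[symmetric]) (auto simp: E\<^sub>1_def)
  qed
  finally show ?thesis .
qed
end

section \<open>Lozenge tilings and columns\<close>

definition column :: "int \<Rightarrow> int set \<Rightarrow> int set \<Rightarrow> utri set" where
  "column i V X = Up i ` V \<union> Down i ` X"

fun col_index :: "utri \<Rightarrow> int" where
  "col_index (Up i j) = i"
| "col_index (Down i j) = i"

lemma column_tiling_of_lift:
  assumes "E \<in> lifts V X"
  shows "(\<lambda>d. {Up i (shift_up E d), Down i d}) ` X \<in> lozenge_tilings (column i V X)"
proof -
  have V: "V = shift_up E ` X" and inj: "inj_on (shift_up E) X" using assms by (auto simp: lifts_def)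
  have "is_lozenge {Up i (shift_up E d), Down i d}" for d
  proof (cases "d \<in> E")
    case True
    then have "{Up i (shift_up E d), Down i d} = {Up i (d + 1), Down i (d + 1 - 1)}" by (simp add: shift_up_def)
    then show ?thesis unfolding is_lozenge_iff is_vertical_lozenge_def by blast
  next
    case False
    then show ?thesis unfolding is_lozenge_iff is_right_lozenge_def by (auto simp: shift_up_def)
  qed
  moreover have "partition_on (column i V X) ((\<lambda>d. {Up i (shift_up E d), Down i d}) ` X)"
  proof (rule partition_onI)
    fix p p' assume "p \<in> (\<lambda>d. {Up i (shift_up E d), Down i d}) ` X"
      "p' \<in> (\<lambda>d. {Up i (shift_up E d), Down i d}) ` X" "p \<noteq> p'"
    then show "disjnt p p'" using inj by (auto simp: disjnt_def inj_on_def)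
  qed (auto simp: column_def V)
  ultimately show ?thesis by (auto simp: lozenge_tilings_def)
qed

text \<open>A left lozenge occupies two adjacent columns, so only right and vertical lozenges fit.
  The set \<open>E\<close> records the vertical ones by the heights of their \<open>Down\<close>
  triangles.\<close>

lemma lift_of_column_tiling:
  assumes "P \<in> lozenge_tilings (column i V X)"
  shows "\<exists>E\<in>lifts V X. P = (\<lambda>d. {Up i (shift_up E d), Down i d}) ` X"
proof -
  define E where "E = {d\<in>X. {Up i (d + 1), Down i d} \<in> P}"
  have part: "partition_on (column i V X) P" and loz: "\<And>L. L \<in> P \<Longrightarrow> is_lozenge L"
    using assms by (auto simp: lozenge_tilings_def)
  have un: "\<Union>P = column i V X" using part by (simp add: partition_on_def)
  have uniq: "L = L'" if "L \<in> P" "L' \<in> P" "T \<in> L" "T \<in> L'" for L L' T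
    using part that unfolding partition_on_def disjoint_def by blast
  have shape: "\<exists>d\<in>X. L = {Up i (shift_up E d), Down i d}" if L: "L \<in> P" for L
  proof -
    have sub: "L \<subseteq> column i V X" using un L by auto
    from loz[OF L] consider (r) i' j where "L = {Up i' j, Down i' j}"
      | (l) i' j where "L = {Up i' j, Down (i' - 1) j}"
      | (v) i' j where "L = {Up i' j, Down i' (j - 1)}"
      unfolding is_lozenge_iff is_right_lozenge_def is_left_lozenge_def is_vertical_lozenge_def by blast
    then show ?thesis
    proof cases
      case r
      then have j: "i' = i" "j \<in> X" using sub by (auto simp: column_def)
      have "j \<notin> E"
      proof
        assume "j \<in> E"
        then have "{Up i (j + 1), Down i j} \<in> P" by (simp add: E_def)
        from uniq[OF this L, of "Down i j"] show False using r j by (auto simp: doubleton_eq_iff)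
      qed
      then show ?thesis using r j by (auto simp: shift_up_def)
    next
      case l
      then show ?thesis using sub by (auto simp: column_def)
    next
      case v
      then have j: "i' = i" "j - 1 \<in> X" using sub by (auto simp: column_def)
      then have "j - 1 \<in> E" using v L by (simp add: E_def)
      then show ?thesis using v j by (intro bexI[of _ "j - 1"]) (auto simp: shift_up_def)
    qed
  qed
  have mem: "{Up i (shift_up E d), Down i d} \<in> P" if d: "d \<in> X" for d
  proof -
    have "Down i d \<in> \<Union>P" using d by (simp add: un column_def)
    then obtain L where L: "L \<in> P" "Down i d \<in> L" by auto
    with shape[OF L(1)] show ?thesis by auto
  qed
  have P: "P = (\<lambda>d. {Up i (shift_up E d), Down i d}) ` X" using shape mem by blast
  have "inj_on (shift_up E) X"
  proof (rule inj_onI)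
    fix d d' assume d: "d \<in> X" "d' \<in> X" "shift_up E d = shift_up E d'"
    from uniq[OF mem[OF d(1)] mem[OF d(2)], of "Up i (shift_up E d)"] d(3)
    show "d = d'" by (auto simp: doubleton_eq_iff)
  qed
  moreover have "shift_up E ` X = V"
  proof (rule Set.set_eqI)
    fix v
    have "v \<in> V \<longleftrightarrow> Up i v \<in> \<Union>P" by (auto simp: un column_def)
    also have "\<dots> \<longleftrightarrow> v \<in> shift_up E ` X" by (auto simp: P)
    finally show "v \<in> shift_up E ` X \<longleftrightarrow> v \<in> V" ..
  qed
  ultimately have "E \<in> lifts V X" by (auto simp: lifts_def E_def)
  then show ?thesis using P by blast
qed

lemma tiling_gf_column:
  assumes "finite X"
  shows "tiling_gf (wt3 q) (column i V X) = of_nat (card (lifts V X))"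
proof -
  let ?f = "\<lambda>E. (\<lambda>d. {Up i (shift_up E d), Down i d}) ` X"
  have inj: "inj_on ?f (lifts V X)"
  proof (rule inj_onI)
    fix E E' assume E: "E \<in> lifts V X" "E' \<in> lifts V X" "?f E = ?f E'"
    have iff: "d \<in> F \<longleftrightarrow> d \<in> X \<and> {Up i (d + 1), Down i d} \<in> ?f F" if "F \<in> lifts V X" for d F
      using that by (auto simp: lifts_def shift_up_def doubleton_eq_iff split: if_splits)
    show "E = E'" using iff[OF E(1)] iff[OF E(2)] unfolding E(3) by auto
  qed
  have img: "?f ` lifts V X = lozenge_tilings (column i V X)"
  proof (intro equalityI subsetI)
    fix P assume "P \<in> ?f ` lifts V X"
    then show "P \<in> lozenge_tilings (column i V X)"
      by (elim imageE) (simp only: column_tiling_of_lift)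
  next
    fix P assume "P \<in> lozenge_tilings (column i V X)"
    from lift_of_column_tiling[OF this] show "P \<in> ?f ` lifts V X" by auto
  qed
  have card: "card (lozenge_tilings (column i V X)) = card (lifts V X)"
    using card_image[OF inj] unfolding img .
  have "(\<Prod>L\<in>P. wt3 q L) = 1" if "P \<in> lozenge_tilings (column i V X)" for P
  proof (rule prod.neutral, intro ballI)
    fix L assume "L \<in> P"
    with lift_of_column_tiling[OF that] obtain j d where "L = {Up i j, Down i d}" by auto
    then have "\<not> is_left_lozenge L" by (auto simp: is_left_lozenge_def doubleton_eq_iff)
    then show "wt3 q L = 1" by (simp add: wt3_def)
  qed
  then show ?thesis by (simp add: tiling_gf_def card)
qed

section \<open>Cutting a region along a lattice line\<close>

lemma lozenge_across_line:
  assumes "is_lozenge L" "L \<subseteq> A \<union> B"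
    and A: "\<And>T. T \<in> A \<Longrightarrow> col_index T < n" and B: "\<And>T. T \<in> B \<Longrightarrow> col_index T \<ge> n"
  shows "L \<subseteq> A \<or> L \<subseteq> B \<or> (\<exists>j. Down (n - 1) j \<in> A \<and> Up n j \<in> B \<and> L = {Up n j, Down (n - 1) j})"
proof -
  from assms(1) consider (r) i j where "L = {Up i j, Down i j}"
      | (l) i j where "L = {Up i j, Down (i - 1) j}"
      | (v) i j where "L = {Up i j, Down i (j - 1)}"
      unfolding is_lozenge_iff is_right_lozenge_def is_left_lozenge_def is_vertical_lozenge_def by blast
  then show ?thesis
  proof cases
    case l
    then consider "Up i j \<in> A" "Down (i - 1) j \<in> A" | "Up i j \<in> B" "Down (i - 1) j \<in> B"
      | "Up i j \<in> A" "Down (i - 1) j \<in> B" | "Up i j \<in> B" "Down (i - 1) j \<in> A"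
      using assms(2) by auto
    then show ?thesis
    proof cases
      case 3
      then show ?thesis using A[of "Up i j"] B[of "Down (i - 1) j"] by auto
    next
      case 4
      then have "i = n" using B[of "Up i j"] A[of "Down (i - 1) j"] by auto
      then show ?thesis using l 4 by auto
    qed (use l in auto)
  qed (use assms(2) A B in fastforce)+
qed

lemma partition_on_parts_eq:
  "partition_on R P \<Longrightarrow> L \<in> P \<Longrightarrow> L' \<in> P \<Longrightarrow> T \<in> L \<Longrightarrow> T \<in> L' \<Longrightarrow> L = L'"
  unfolding partition_on_def disjoint_def by blast

lemma partition_on_union:
  assumes "partition_on A P" "partition_on B Q" "A \<inter> B = {}"
  shows "partition_on (A \<union> B) (P \<union> Q)"
  using assms by (auto simp: partition_on_def intro!: disjoint_union)

text \<open>Only left lozenges cross the line. A tiling therefore amounts to the set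
  \<open>J\<close> of heights at which they cross, together with tilings of what remains on the two
  sides; \<open>glue\<close> is this bijection.\<close>

lemma tiling_gf_cut:
  fixes w :: "utri set \<Rightarrow> 'a::comm_semiring_1"
  assumes fin: "finite A" "finite B"
    and A: "\<And>T. T \<in> A \<Longrightarrow> col_index T < n" and B: "\<And>T. T \<in> B \<Longrightarrow> col_index T \<ge> n"
  shows "tiling_gf w (A \<union> B)
    = (\<Sum>J\<in>Pow {j. Down (n - 1) j \<in> A \<and> Up n j \<in> B}.
        (\<Prod>j\<in>J. w {Up n j, Down (n - 1) j})
        * tiling_gf w (A - Down (n - 1) ` J) * tiling_gf w (B - Up n ` J))"
proof -
  define cl where "cl j = {Up n j, Down (n - 1) j}" for j
  define JJ where "JJ = {j. Down (n - 1) j \<in> A \<and> Up n j \<in> B}"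
  define TA where "TA J = lozenge_tilings (A - Down (n - 1) ` J)" for J
  define TB where "TB J = lozenge_tilings (B - Up n ` J)" for J
  have inj_cl: "inj_on cl J" for J by (auto simp: inj_on_def cl_def doubleton_eq_iff)
  have disjAB: "A \<inter> B = {}" using A B by fastforce
  have "finite (Down (n - 1) ` JJ)" by (rule finite_subset[OF _ fin(1)]) (auto simp: JJ_def)
  then have finJJ: "finite JJ" by (rule finite_imageD) (simp add: inj_on_def)
  have finT: "finite (TA J)" "finite (TB J)" for J
    unfolding TA_def TB_def using fin by (auto intro: finite_lozenge_tilings)
  define glue where "glue = (\<lambda>(J, P, P'). cl ` J \<union> P \<union> P')"
  define S where "S = (SIGMA J:Pow JJ. TA J \<times> TB J)"
  have sub: "\<Union>P = A - Down (n - 1) ` J" "\<Union>P' = B - Up n ` J" "{} \<notin> P" "{} \<notin> P'"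
    if "(J, P, P') \<in> S" for J P P'
    using that by (auto simp: S_def TA_def TB_def lozenge_tilings_def partition_on_def)
  have glue_in: "glue s \<in> lozenge_tilings (A \<union> B)" if "s \<in> S" for s
  proof -
    obtain J P P' where s: "s = (J, P, P')" by (cases s) auto
    have JP: "J \<subseteq> JJ" "P \<in> TA J" "P' \<in> TB J" using that by (auto simp: s S_def)
    have un: "\<Union>(cl ` J) = Down (n - 1) ` J \<union> Up n ` J" by (auto simp: cl_def)
    have parts: "partition_on (\<Union>(cl ` J)) (cl ` J)"
      by (rule partition_onI) (auto simp: cl_def disjnt_def)
    have pP: "partition_on (A - Down (n - 1) ` J) P" "partition_on (B - Up n ` J) P'"
      using JP by (auto simp: TA_def TB_def lozenge_tilings_def)
    have sets: "Down (n - 1) ` J \<subseteq> A" "Up n ` J \<subseteq> B" using JP by (auto simp: JJ_def)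
    have "partition_on (\<Union>(cl ` J) \<union> (A - Down (n - 1) ` J) \<union> (B - Up n ` J)) (cl ` J \<union> P \<union> P')"
      by (intro partition_on_union parts pP) (use sets disjAB un in auto)
    moreover have "\<Union>(cl ` J) \<union> (A - Down (n - 1) ` J) \<union> (B - Up n ` J) = A \<union> B"
      unfolding un using sets by auto
    moreover have "is_lozenge (cl j)" for j
      unfolding is_lozenge_iff is_left_lozenge_def cl_def by blast
    ultimately show ?thesis
      using JP unfolding s glue_def lozenge_tilings_def TA_def TB_def by auto
  qed
  have recover: "{j. cl j \<in> glue s} = J \<and> {L\<in>glue s. L \<subseteq> A} = P \<and> {L\<in>glue s. L \<subseteq> B} = P'"
    if "s \<in> S" "s = (J, P, P')" for s J P P'
  proof -
    note sb = sub[OF that(1)[unfolded that(2)]]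
    have g: "glue s = cl ` J \<union> P \<union> P'" using that by (simp add: glue_def)
    have "J \<subseteq> JJ" using that by (auto simp: S_def)
    then have cl: "\<not> cl j \<subseteq> A" "\<not> cl j \<subseteq> B" if "j \<in> J" for j
      using that disjAB by (auto simp: cl_def JJ_def)
    \<comment> \<open>Parts are nonempty and the two sides are disjoint, so sorting the parts by the
      side that contains them recovers the triple.\<close>
    have ne: "\<not> (L \<subseteq> A \<and> L \<subseteq> B)" if "L \<in> P \<union> P'" for L
    proof -
      have "L \<noteq> {}" using sb(3,4) that by auto
      then show ?thesis using disjAB by auto
    qed
    have PA: "L \<subseteq> A" "\<not> L \<subseteq> B" if "L \<in> P" for L
    proof -
      show "L \<subseteq> A" using sb(1) that by auto
      then show "\<not> L \<subseteq> B" using ne[of L] that by auto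
    qed
    have PB: "L \<subseteq> B" "\<not> L \<subseteq> A" if "L \<in> P'" for L
    proof -
      show "L \<subseteq> B" using sb(2) that by auto
      then show "\<not> L \<subseteq> A" using ne[of L] that by auto
    qed
    have "cl j \<notin> P" for j using PA(1)[of "cl j"] A[of "Up n j"] by (auto simp: cl_def)
    moreover have "cl j \<notin> P'" for j using PB(1)[of "cl j"] B[of "Down (n - 1) j"] by (auto simp: cl_def)
    moreover have "cl j \<in> cl ` J \<longleftrightarrow> j \<in> J" for j using inj_cl[of UNIV] by (auto dest: injD)
    ultimately have "{j. cl j \<in> glue s} = J" unfolding g by auto
    moreover have "{L\<in>glue s. L \<subseteq> A} = P" unfolding g using cl(1) PA(1) PB(2) by auto
    moreover have "{L\<in>glue s. L \<subseteq> B} = P'" unfolding g using cl(2) PA(2) PB(1) by auto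
    ultimately show ?thesis by simp
  qed
  have onto: "\<exists>s\<in>S. glue s = P" if P: "P \<in> lozenge_tilings (A \<union> B)" for P
  proof -
    define J where "J = {j. cl j \<in> P}"
    define P\<^sub>A where "P\<^sub>A = {L\<in>P. L \<subseteq> A}"
    define P\<^sub>B where "P\<^sub>B = {L\<in>P. L \<subseteq> B}"
    have part: "partition_on (A \<union> B) P" and loz: "\<And>L. L \<in> P \<Longrightarrow> is_lozenge L"
      using P by (auto simp: lozenge_tilings_def)
    note uniq = partition_on_parts_eq[OF part]
    have un: "\<Union>P = A \<union> B" and ne: "{} \<notin> P" and dis: "disjoint P"
      using part by (auto simp: partition_on_def)
    have J: "J \<subseteq> JJ"
    proof
      fix j assume "j \<in> J"
      then have "Up n j \<in> A \<union> B" "Down (n - 1) j \<in> A \<union> B" using un by (auto simp: J_def cl_def)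
      then show "j \<in> JJ" using A[of "Up n j"] B[of "Down (n - 1) j"] by (auto simp: JJ_def)
    qed
    have cases: "L \<in> P\<^sub>A \<or> L \<in> P\<^sub>B \<or> L \<in> cl ` J" if L: "L \<in> P" for L
      using lozenge_across_line[OF loz[OF L] _ A B] L un
      by (auto simp: P\<^sub>A_def P\<^sub>B_def J_def cl_def)
    have P_eq: "P = cl ` J \<union> P\<^sub>A \<union> P\<^sub>B"
      using cases by (auto simp: P\<^sub>A_def P\<^sub>B_def J_def)
    have "\<Union>P\<^sub>A = A - Down (n - 1) ` J"
    proof (intro Set.set_eqI iffI)
      fix T assume T: "T \<in> \<Union>P\<^sub>A"
      then obtain L where L: "L \<in> P" "L \<subseteq> A" "T \<in> L" by (auto simp: P\<^sub>A_def)
      have "T \<noteq> Down (n - 1) j" if "j \<in> J" for j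
      proof
        assume "T = Down (n - 1) j"
        then have "L = cl j" using uniq[OF L(1), of "cl j" T] that L by (auto simp: J_def cl_def)
        then show False using L A[of "Up n j"] by (auto simp: cl_def)
      qed
      then show "T \<in> A - Down (n - 1) ` J" using L by auto
    next
      fix T assume T: "T \<in> A - Down (n - 1) ` J"
      then obtain L where L: "L \<in> P" "T \<in> L" using un by blast
      from cases[OF L(1)] show "T \<in> \<Union>P\<^sub>A"
      proof (elim disjE)
        assume "L \<in> P\<^sub>B"
        then show ?thesis using L T disjAB by (auto simp: P\<^sub>B_def)
      next
        assume "L \<in> cl ` J"
        then show ?thesis using L T A[of T] by (auto simp: cl_def)
      qed (use L in auto)
    qed
    then have 1: "P\<^sub>A \<in> TA J"
      using loz ne dis unfolding TA_def lozenge_tilings_def partition_on_def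
      by (auto simp: P\<^sub>A_def disjoint_def)
    have "\<Union>P\<^sub>B = B - Up n ` J"
    proof (intro Set.set_eqI iffI)
      fix T assume T: "T \<in> \<Union>P\<^sub>B"
      then obtain L where L: "L \<in> P" "L \<subseteq> B" "T \<in> L" by (auto simp: P\<^sub>B_def)
      have "T \<noteq> Up n j" if "j \<in> J" for j
      proof
        assume "T = Up n j"
        then have "L = cl j" using uniq[OF L(1), of "cl j" T] that L by (auto simp: J_def cl_def)
        then show False using L B[of "Down (n - 1) j"] by (auto simp: cl_def)
      qed
      then show "T \<in> B - Up n ` J" using L by auto
    next
      fix T assume T: "T \<in> B - Up n ` J"
      then obtain L where L: "L \<in> P" "T \<in> L" using un by blast
      from cases[OF L(1)] show "T \<in> \<Union>P\<^sub>B"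
      proof (elim disjE)
        assume "L \<in> P\<^sub>A"
        then show ?thesis using L T disjAB by (auto simp: P\<^sub>A_def)
      next
        assume "L \<in> cl ` J"
        then show ?thesis using L T B[of T] by (auto simp: cl_def)
      qed (use L in auto)
    qed
    then have 2: "P\<^sub>B \<in> TB J"
      using loz ne dis unfolding TB_def lozenge_tilings_def partition_on_def
      by (auto simp: P\<^sub>B_def disjoint_def)
    show ?thesis
      using 1 2 J P_eq by (intro bexI[of _ "(J, P\<^sub>A, P\<^sub>B)"]) (auto simp: S_def glue_def)
  qed
  have "inj_on glue S"
  proof (rule inj_onI)
    fix s s' assume "s \<in> S" "s' \<in> S" "glue s = glue s'"
    then show "s = s'" using recover[of s] recover[of s'] by (cases s; cases s') auto
  qed
  moreover have "glue ` S = lozenge_tilings (A \<union> B)" using glue_in onto by blast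
  ultimately have "tiling_gf w (A \<union> B) = (\<Sum>s\<in>S. \<Prod>L\<in>glue s. w L)"
    unfolding tiling_gf_def by (metis (no_types, lifting) sum.reindex_cong)
  also have "\<dots> = (\<Sum>(J, P, P')\<in>S. (\<Prod>j\<in>J. w (cl j)) * ((\<Prod>L\<in>P. w L) * (\<Prod>L\<in>P'. w L)))"
  proof (intro sum.cong refl)
    fix s assume s: "s \<in> S"
    obtain J P P' where seq: "s = (J, P, P')" by (cases s) auto
    have JP: "J \<subseteq> JJ" "P \<in> TA J" "P' \<in> TB J" using s by (auto simp: seq S_def)
    have finP: "finite J" "finite P" "finite P'"
      using JP finJJ fin finite_subset unfolding TA_def TB_def
      by (auto intro: finite_subset finite_lozenge_tilings(2)[rotated])
    note r = recover[OF s seq]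
    have d: "cl ` J \<inter> P = {}" "(cl ` J \<union> P) \<inter> P' = {}"
    proof -
      have *: "\<not> cl j \<subseteq> A" "\<not> cl j \<subseteq> B" if "j \<in> J" for j
        using that JP(1) disjAB by (auto simp: cl_def JJ_def)
      have PA: "L \<subseteq> A" "L \<noteq> {}" if "L \<in> P" for L using r sub(3)[of J P P'] s seq that by auto
      have PB: "L \<subseteq> B" if "L \<in> P'" for L using r that by auto
      have 1: "cl j \<notin> P" "cl j \<notin> P'" if "j \<in> J" for j
        using *[OF that] PA(1) PB by auto
      have 2: "L \<notin> P'" if "L \<in> P" for L
        using PA[OF that] PB[of L] disjAB by auto
      show "cl ` J \<inter> P = {}" "(cl ` J \<union> P) \<inter> P' = {}" using 1 2 by auto
    qed
    have "(\<Prod>L\<in>glue s. w L) = (\<Prod>L\<in>cl ` J. w L) * (\<Prod>L\<in>P. w L) * (\<Prod>L\<in>P'. w L)"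
      unfolding seq glue_def using finP d by (simp add: prod.union_disjoint)
    also have "(\<Prod>L\<in>cl ` J. w L) = (\<Prod>j\<in>J. w (cl j))"
      by (simp add: prod.reindex[OF inj_cl])
    finally show "(\<Prod>L\<in>glue s. w L) = (case s of (J, P, P') \<Rightarrow>
        (\<Prod>j\<in>J. w (cl j)) * ((\<Prod>L\<in>P. w L) * (\<Prod>L\<in>P'. w L)))"
      by (simp add: seq mult.assoc)
  qed
  also have "\<dots> = (\<Sum>J\<in>Pow JJ. \<Sum>(P, P')\<in>TA J \<times> TB J.
      (\<Prod>j\<in>J. w (cl j)) * ((\<Prod>L\<in>P. w L) * (\<Prod>L\<in>P'. w L)))"
    unfolding S_def using finJJ finT by (subst sum.Sigma) (auto simp: case_prod_unfold)
  also have "\<dots> = (\<Sum>J\<in>Pow JJ. (\<Prod>j\<in>J. w (cl j)) * tiling_gf w (A - Down (n - 1) ` J)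
      * tiling_gf w (B - Up n ` J))"
    unfolding tiling_gf_def TA_def[symmetric] TB_def[symmetric]
    by (intro sum.cong refl, simp only: mult.assoc sum_product sum.cartesian_product)
      (simp add: sum_distrib_left case_prod_unfold)
  finally show ?thesis by (simp add: JJ_def cl_def)
qed

text \<open>
  \<open>D k\<close> and \<open>U k\<close> are the heights of the \<open>Down\<close> and \<open>Up\<close> triangles to the left and to the right of the \<open>k\<close>-th line;
  they differ where a removed triangle begins. \<open>X\<close> replaces the last set \<open>D k\<close>.
\<close>

primrec strip_gf :: "'a::comm_semiring_1 \<Rightarrow> (nat \<Rightarrow> int set) \<Rightarrow> (nat \<Rightarrow> int set) \<Rightarrow> nat \<Rightarrow> int set \<Rightarrow> 'a" where
  "strip_gf q U D 0 X = of_bool (X = D 0)"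
| "strip_gf q U D (Suc k) X = (\<Sum>J\<in>Pow (D k \<inter> U k).
     (\<Prod>j\<in>J. q ^ nat (j + 1)) * strip_gf q U D k (D k - J) * of_nat (card (lifts (U k - J) X)))"

definition strip :: "int \<Rightarrow> (nat \<Rightarrow> int set) \<Rightarrow> (nat \<Rightarrow> int set) \<Rightarrow> nat \<Rightarrow> utri set" where
  "strip i U D m = (\<Union>k<m. column (i + int k) (U k) (D (Suc k)))"

text \<open>The last column carries an arbitrary set \<open>X\<close>, because cutting off the next
  column deletes from it the \<open>Down\<close> triangles that belong to crossing lozenges.\<close>

lemma M3_strip_column:
  assumes "\<And>k. finite (U k)" "\<And>k. finite (D k)" "finite X"
  shows "M3 q (strip i U D k \<union> column (i + int k) (U k) X) = strip_gf q U D (Suc k) X"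
  using assms(3)
proof (induction k arbitrary: X)
  case 0
  \<comment> \<open>Nothing lies to the left of the first line. The initial value of
    \<open>strip_gf\<close> expresses this by forcing \<open>J = {}\<close>, that is, no lozenge
    crosses that line.\<close>
  have "strip_gf q U D (Suc 0) X = (\<Sum>J\<in>{{}}. (\<Prod>j\<in>J. q ^ nat (j + 1))
      * strip_gf q U D 0 (D 0 - J) * of_nat (card (lifts (U 0 - J) X)))"
    unfolding strip_gf.simps using assms(1,2) by (intro sum.mono_neutral_right) auto
  then show ?case using 0 by (simp add: strip_def M3_def tiling_gf_column)
next
  case (Suc k)
  let ?n = "i + int (Suc k)"
  let ?A = "strip i U D (Suc k)" and ?B = "column ?n (U (Suc k)) X"
  have A: "?A = strip i U D k \<union> column (i + int k) (U k) (D (Suc k))"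
    by (simp add: strip_def lessThan_Suc Un_commute)
  have idx: "col_index T < i + int m" if "T \<in> strip i U D m" for T m
    using that by (auto simp: strip_def column_def)
  have fin: "finite ?A" "finite ?B"
    using assms(1,2) Suc.prems by (auto simp: strip_def column_def)
  have J: "{j. Down (?n - 1) j \<in> ?A \<and> Up ?n j \<in> ?B} = D (Suc k) \<inter> U (Suc k)"
    unfolding A using idx[of _ k] by (force simp: column_def)
  have "M3 q (?A \<union> ?B) = (\<Sum>J\<in>Pow (D (Suc k) \<inter> U (Suc k)).
        (\<Prod>j\<in>J. wt3 q {Up ?n j, Down (?n - 1) j})
        * tiling_gf (wt3 q) (?A - Down (?n - 1) ` J) * tiling_gf (wt3 q) (?B - Up ?n ` J))"
    unfolding M3_def J[symmetric]
    by (rule tiling_gf_cut[OF fin]) (use idx[of _ "Suc k"] in \<open>auto simp: column_def\<close>)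
  also have "\<dots> = strip_gf q U D (Suc (Suc k)) X"
    unfolding strip_gf.simps(2)[of q U D "Suc k" X]
  proof (intro sum.cong refl)
    fix J assume J: "J \<in> Pow (D (Suc k) \<inter> U (Suc k))"
    have "is_left_lozenge {Up ?n j, Down (?n - 1) j}" for j
      unfolding is_left_lozenge_def by blast
    then have "wt3 q {Up ?n j, Down (?n - 1) j} = q ^ nat (j + 1)" for j
      unfolding wt3_def top_height_left by (simp only: if_True)
    moreover have "?A - Down (?n - 1) ` J = strip i U D k \<union> column (i + int k) (U k) (D (Suc k) - J)"
      unfolding A using idx[of _ k] by (force simp: column_def)
    moreover have "?B - Up ?n ` J = column ?n (U (Suc k) - J) X" by (auto simp: column_def)
    ultimately show "(\<Prod>j\<in>J. wt3 q {Up ?n j, Down (?n - 1) j})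
        * tiling_gf (wt3 q) (?A - Down (?n - 1) ` J) * tiling_gf (wt3 q) (?B - Up ?n ` J)
      = (\<Prod>j\<in>J. q ^ nat (j + 1)) * strip_gf q U D (Suc k) (D (Suc k) - J)
        * of_nat (card (lifts (U (Suc k) - J) X))"
      using Suc.IH[of "D (Suc k) - J", unfolded M3_def] assms(2) Suc.prems
      by (simp only: tiling_gf_column finite_Diff)
  qed
  finally show ?case .
qed

lemma M3_strip:
  assumes "\<And>k. finite (U k)" "\<And>k. finite (D k)"
  shows "M3 q (strip i U D m) = strip_gf q U D m (D m)"
proof (cases m)
  case 0
  have "lozenge_tilings {} = {{}}" by (auto simp: lozenge_tilings_def partition_on_empty)
  then show ?thesis using 0 by (simp add: strip_def M3_def tiling_gf_def)
next
  case (Suc k)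
  have "strip i U D m = strip i U D k \<union> column (i + int k) (U k) (D (Suc k))"
    by (simp add: strip_def lessThan_Suc Un_commute Suc)
  then show ?thesis using M3_strip_column[of U D "D (Suc k)" q i k] assms by (simp only: Suc)
qed

section \<open>The region as a sequence of columns\<close>

lemma Pow_diff_reindex:
  "(\<Sum>J\<in>Pow I. g J) = (\<Sum>V\<in>Pow I. g (I - V))"
  by (rule sum.reindex_bij_witness[of _ "\<lambda>V. I - V" "\<lambda>V. I - V"]) (auto simp: double_diff)

lemma lifts_nonempty_subset:
  assumes "card (lifts V X) \<noteq> 0" "X \<subseteq> {l..h}"
  shows "V \<subseteq> {l..h + 1}"
proof -
  from assms(1) have "lifts V X \<noteq> {}" by force
  then obtain E where "V = shift_up E ` X" by (auto simp: lifts_def)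
  then show ?thesis using shift_up_image_subset[OF assms(2)] by simp
qed

context generic_q
begin

text \<open>The crossed segments are the complement of the holes, so their weight is that of the
  full line corrected at the holes. Since heights are non-negative, \<open>nat (j + 1)\<close> is
  the true exponent.\<close>

lemma prod_power_diff_eq_hole_wt:
  assumes "finite I" "V \<subseteq> I" "I \<subseteq> {0..}"
  shows "(\<Prod>j\<in>I - V. q ^ nat (j + 1)) = inverse (hole_wt q I) * hole_wt q V"
proof -
  have "q ^ nat (j + 1) = inverse (q powi (- (j + 1)))" if "j \<in> I" for j
    using that assms(3) by (subst power_int_minus) (auto simp: power_int_def)
  then have "(\<Prod>j\<in>I - V. q ^ nat (j + 1)) = inverse (hole_wt q (I - V))"
    unfolding hole_wt_def prod_inversef[symmetric] comp_def by (intro prod.cong) auto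
  moreover have "hole_wt q I = hole_wt q (I - V) * hole_wt q V"
    unfolding hole_wt_def by (rule prod.subset_diff) (use assms in auto)
  ultimately show ?thesis using hole_wt_nonzero[of V] by simp
qed

lemma transfer_eq_path_sum:
  fixes lo hi :: "nat \<Rightarrow> int"
  defines "I m \<equiv> {lo m..<hi m}"
  assumes step: "\<And>m X. m < M \<Longrightarrow> X \<subseteq> I (Suc m) \<Longrightarrow> f (Suc m) X
      = (\<Sum>V\<in>Pow (I m). (\<Prod>j\<in>I m - V. q ^ nat (j + 1)) * f m V * of_nat (card (lifts V X)))"
    and lo: "\<And>m. m < M \<Longrightarrow> lo m \<le> max (lo 0 - int m) (lo (Suc m))"
    and hi: "\<And>m. m < M \<Longrightarrow> min (hi 0) (hi (Suc m) + 1) \<le> hi m"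
    and pos: "\<And>m. m < M \<Longrightarrow> 0 \<le> lo m"
    and "m \<le> M" "X \<subseteq> I m"
  shows "f m X = (\<Prod>l<m. inverse (hole_wt q (I l))) * (\<Sum>V\<in>Pow (I 0). f 0 V * path_sum q m V X)"
  using assms(6,7)
proof (induction m arbitrary: X)
  case 0
  have "(\<Sum>V\<in>Pow (I 0). f 0 V * path_sum q 0 V X) = (\<Sum>V\<in>{X}. f 0 V * path_sum q 0 V X)"
    using 0 by (intro sum.mono_neutral_right) (auto simp: I_def)
  then show ?case by simp
next
  case (Suc m)
  let ?K = "\<Prod>l<m. inverse (hole_wt q (I l))"
  have m: "m < M" using Suc.prems by simp
  have X: "X \<subseteq> {lo (Suc m)..hi (Suc m) - 1}" using Suc.prems by (auto simp: I_def)
  have path_sum: "(\<Sum>W\<in>Pow (I m). of_nat (card (lifts W X)) * (hole_wt q W * path_sum q m V W)) = path_sum q (Suc m) V X"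
    if V: "V \<in> Pow (I 0)" for V
    unfolding path_sum_Suc_lifts[OF X]
  proof (rule sum.mono_neutral_cong)
    fix W assume W: "W \<in> Pow {lo (Suc m)..hi (Suc m) - 1 + 1} - Pow (I m)"
    show "of_nat (card (lifts W X)) * (hole_wt q W * path_sum q m V W) = 0"
    proof (rule ccontr)
      assume "\<not> ?thesis"
      then have "path_sum q m V W \<noteq> 0" by auto
      moreover have "V \<subseteq> {lo 0..hi 0 - 1}" using V by (auto simp: I_def)
      ultimately have "W \<subseteq> {lo 0 - int m..hi 0 - 1}" by (rule path_sum_support_end)
      then have "W \<subseteq> I m" using W lo[OF m] hi[OF m] unfolding I_def by fastforce
      then show False using W by auto
    qed
  next
    fix W assume W: "W \<in> Pow (I m) - Pow {lo (Suc m)..hi (Suc m) - 1 + 1}"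
    then have "card (lifts W X) = 0"
      using lifts_nonempty_subset[OF _ X, of W] by blast
    then show "of_nat (card (lifts W X)) * (hole_wt q W * path_sum q m V W) = 0" by simp
  qed (auto simp: I_def)
  have "f (Suc m) X = (\<Sum>W\<in>Pow (I m). (inverse (hole_wt q (I m)) * hole_wt q W)
      * (?K * (\<Sum>V\<in>Pow (I 0). f 0 V * path_sum q m V W)) * of_nat (card (lifts W X)))"
    unfolding step[OF m Suc.prems(2)]
    using Suc.IH Suc.prems pos[OF m] by (intro sum.cong refl arg_cong2[where f = times]
      prod_power_diff_eq_hole_wt) (auto simp: I_def)
  also have "\<dots> = (\<Sum>W\<in>Pow (I m). \<Sum>V\<in>Pow (I 0). inverse (hole_wt q (I m)) * ?K * f 0 V
      * (of_nat (card (lifts W X)) * (hole_wt q W * path_sum q m V W)))"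
    by (simp add: sum_distrib_left sum_distrib_right mult_ac)
  also have "\<dots> = (\<Sum>V\<in>Pow (I 0). inverse (hole_wt q (I m)) * ?K * f 0 V * path_sum q (Suc m) V X)"
    by (subst sum.swap) (simp only: sum_distrib_left[symmetric] path_sum cong: sum.cong)
  also have "\<dots> = (\<Prod>l<Suc m. inverse (hole_wt q (I l))) * (\<Sum>V\<in>Pow (I 0). f 0 V * path_sum q (Suc m) V X)"
    by (simp add: sum_distrib_left mult_ac del: path_sum.simps)
  finally show ?case .
qed

end

section \<open>The columns of the region in coordinates\<close>

lemma mem_tris_hexagon:
  "Up i j \<in> tris (hexagon nw sw s se) \<longleftrightarrow> 0 \<le> j \<and> j + 1 \<le> int (sw + nw) \<and> - int sw \<le> i \<and> i + 1 \<le> int s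
    \<and> 0 \<le> i + j \<and> i + j + 1 \<le> int (s + se)"
  "Down i j \<in> tris (hexagon nw sw s se) \<longleftrightarrow> 0 \<le> j \<and> j + 1 \<le> int (sw + nw) \<and> - int sw \<le> i \<and> i + 1 \<le> int s
    \<and> 0 \<le> i + j + 1 \<and> i + j + 2 \<le> int (s + se)"
  by (auto simp: tris_def hexagon_def)

lemma mem_tris_up_triangle:
  "Up i j \<in> tris (up_triangle i\<^sub>0 j\<^sub>0 n) \<longleftrightarrow> i\<^sub>0 \<le> i \<and> j\<^sub>0 \<le> j \<and> i + j + 1 \<le> i\<^sub>0 + j\<^sub>0 + int n"
  "Down i j \<in> tris (up_triangle i\<^sub>0 j\<^sub>0 n) \<longleftrightarrow> i\<^sub>0 \<le> i \<and> j\<^sub>0 \<le> j \<and> i + j + 2 \<le> i\<^sub>0 + j\<^sub>0 + int n"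
  by (auto simp: tris_def up_triangle_def)

locale Q_params =
  fixes a b x y z t :: nat
begin

text \<open>
  \<open>left_line k\<close> lies on the line \<open>i = k - (y + t)\<close>, and \<open>right_line k\<close> on the line \<open>i = x + k\<close>, outside the removed
  triangles.
\<close>

definition left_line :: "nat \<Rightarrow> int set" where
  "left_line k = {max 0 (int (y + t) - int k)..<
     min (int (y + t + z + a + b)) (int (y + z + a + b + (x + y + t)) - int k)}"

definition right_line :: "nat \<Rightarrow> int set" where
  "right_line k = {max 0 (int a - int k)..<min (int (a + y + z)) (int (y + z + a + b) - int k)}"

text \<open>The comparison is strict here and weak in \<open>down_line\<close>: on the line through
  the left sides of the removed triangles, the \<open>Up\<close> triangles to its right already see
  the gaps, while the \<open>Down\<close> triangles to its left do not.\<close>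

definition up_line :: "nat \<Rightarrow> int set" where
  "up_line k = (if k < x + y + t then left_line k else right_line (k - (x + y + t)))"

definition down_line :: "nat \<Rightarrow> int set" where
  "down_line k = (if k \<le> x + y + t then left_line k else right_line (k - (x + y + t)))"

lemma finite_lines: "finite (left_line k)" "finite (right_line k)" "finite (up_line k)" "finite (down_line k)"
  by (auto simp: left_line_def right_line_def up_line_def down_line_def)

lemma Q_region_eq_strip:
  "Q_region a b x y z t = strip (- int (y + t)) up_line down_line (x + y + t + (y + a + b))"
proof (rule Set.set_eqI)
  fix T
  show "T \<in> Q_region a b x y z t \<longleftrightarrow> T \<in> strip (- int (y + t)) up_line down_line (x + y + t + (y + a + b))"
  proof (cases T)
    case (Up i j)
    have "T \<in> strip (- int (y + t)) up_line down_line (x + y + t + (y + a + b)) \<longleftrightarrow>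
        - int (y + t) \<le> i \<and> i < int (x + y + a + b) \<and> j \<in> up_line (nat (i + int (y + t)))"
    proof
      assume "- int (y + t) \<le> i \<and> i < int (x + y + a + b) \<and> j \<in> up_line (nat (i + int (y + t)))"
      then show "T \<in> strip (- int (y + t)) up_line down_line (x + y + t + (y + a + b))"
        unfolding strip_def column_def Up
        by (intro UN_I[of "nat (i + int (y + t))"]) auto
    qed (auto simp: strip_def column_def Up)
    also have "\<dots> \<longleftrightarrow> T \<in> Q_region a b x y z t"
    proof (cases "i < int x")
      case True
      then show ?thesis
        unfolding Up Q_region_def Diff_iff mem_tris_hexagon mem_tris_up_triangle up_line_def left_line_def
        by auto
    next
      case False
      have "up_line (nat (i + int (y + t))) = right_line (nat (i - int x))"
        using False by (auto simp: up_line_def intro!: arg_cong[where f = right_line])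
      then show ?thesis
        using False unfolding Up Q_region_def Diff_iff mem_tris_hexagon mem_tris_up_triangle right_line_def
        by auto
    qed
    finally show ?thesis ..
  next
    case (Down i j)
    have "T \<in> strip (- int (y + t)) up_line down_line (x + y + t + (y + a + b)) \<longleftrightarrow>
        - int (y + t) \<le> i \<and> i < int (x + y + a + b) \<and> j \<in> down_line (Suc (nat (i + int (y + t))))"
    proof
      assume "- int (y + t) \<le> i \<and> i < int (x + y + a + b) \<and> j \<in> down_line (Suc (nat (i + int (y + t))))"
      then show "T \<in> strip (- int (y + t)) up_line down_line (x + y + t + (y + a + b))"
        unfolding strip_def column_def Down
        by (intro UN_I[of "nat (i + int (y + t))"]) auto
    qed (auto simp: strip_def column_def Down)
    also have "\<dots> \<longleftrightarrow> T \<in> Q_region a b x y z t"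
    proof (cases "i < int x")
      case True
      then show ?thesis
        unfolding Down Q_region_def Diff_iff mem_tris_hexagon mem_tris_up_triangle down_line_def left_line_def
        by auto
    next
      case False
      have "down_line (Suc (nat (i + int (y + t)))) = right_line (nat (i + 1 - int x))"
        using False by (auto simp: down_line_def intro!: arg_cong[where f = right_line])
      then show ?thesis
        using False unfolding Down Q_region_def Diff_iff mem_tris_hexagon mem_tris_up_triangle right_line_def
        by auto
    qed
    finally show ?thesis ..
  qed
qed

end

locale generic_Q = generic_q q + Q_params a b x y z t
  for q :: "'a::field" and a b x y z t :: nat
begin

lemma strip_gf_left:
  assumes "k \<le> x + y + t" "X \<subseteq> left_line k"
  shows "strip_gf q up_line down_line k X
    = (\<Prod>l<k. inverse (hole_wt q (left_line l))) * path_sum q k {int (y + t)..<int (y + t) + int (z + a + b)} X"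
proof -
  let ?lo = "\<lambda>k. max 0 (int (y + t) - int k)"
  let ?hi = "\<lambda>k. min (int (y + t + z + a + b)) (int (y + z + a + b + (x + y + t)) - int k)"
  let ?f = "strip_gf q up_line down_line"
  have step: "?f (Suc m) X' = (\<Sum>V\<in>Pow {?lo m..<?hi m}. (\<Prod>j\<in>{?lo m..<?hi m} - V. q ^ nat (j + 1))
      * ?f m V * of_nat (card (lifts V X')))" if "m < x + y + t" for m X'
  proof -
    have lines: "down_line m = {?lo m..<?hi m}" "up_line m = {?lo m..<?hi m}"
      using that by (simp_all add: up_line_def down_line_def left_line_def)
    show ?thesis
      unfolding strip_gf.simps lines Int_absorb by (subst Pow_diff_reindex) (auto intro!: sum.cong simp: double_diff)
  qed
  have start: "left_line 0 = {int (y + t)..<int (y + t) + int (z + a + b)}"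
    by (auto simp: left_line_def)
  have "?f k X = (\<Prod>l<k. inverse (hole_wt q {?lo l..<?hi l})) * (\<Sum>V\<in>Pow {?lo 0..<?hi 0}. ?f 0 V * path_sum q k V X)"
    by (rule transfer_eq_path_sum[where M = "x + y + t"])
      (use assms step in \<open>auto simp: left_line_def\<close>)
  also have "\<dots> = (\<Prod>l<k. inverse (hole_wt q (left_line l))) * (\<Sum>V\<in>Pow (left_line 0). ?f 0 V * path_sum q k V X)"
    by (simp only: left_line_def)
  also have "(\<Sum>V\<in>Pow (left_line 0). ?f 0 V * path_sum q k V X) = (\<Sum>V\<in>{left_line 0}. ?f 0 V * path_sum q k V X)"
    using finite_lines(1) by (intro sum.mono_neutral_right) (auto simp: down_line_def)
  also have "\<dots> = path_sum q k (left_line 0) X" by (simp add: down_line_def)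
  finally show ?thesis unfolding start .
qed

lemma M3_Q_region_eq_path_sum:
  "M3 q (Q_region a b x y z t)
    = (\<Prod>l<x + y + t. inverse (hole_wt q (left_line l))) * (\<Prod>l<y + a + b. inverse (hole_wt q (right_line l)))
      * (\<Sum>H\<in>Pow {int a..<int (a + y + z)}.
          path_sum q (x + y + t) {int (y + t)..<int (y + t) + int (z + a + b)}
            (H \<union> {0..<int a} \<union> {int (a + y + z)..<int (a + y + z + b)})
          * path_sum q (y + a + b) H {0..<0 + int z})"
proof -
  let ?N = "x + y + t" and ?k = "y + a + b"
  let ?lo = "\<lambda>k. max 0 (int a - int k)"
  let ?hi = "\<lambda>k. min (int (a + y + z)) (int (y + z + a + b) - int k)"
  let ?C = "{0..<int a} \<union> {int (a + y + z)..<int (a + y + z + b)}"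
  \<comment> \<open>At the cut, \<open>?C\<close> is added to the holes: no lozenge crosses a side
    of a removed triangle, so these segments are holes for every tiling of the left part.\<close>
  define f where "f m X = (if m = 0 then strip_gf q up_line down_line ?N (X \<union> ?C)
    else strip_gf q up_line down_line (?N + m) X)" for m X
  have right: "right_line m = {?lo m..<?hi m}" for m by (simp add: right_line_def)
  have right0: "right_line 0 = {int a..<int (a + y + z)}" by (auto simp: right_line_def)
  have leftN: "left_line ?N = right_line 0 \<union> ?C" by (auto simp: left_line_def right_line_def)
  have step: "f (Suc m) X = (\<Sum>V\<in>Pow {?lo m..<?hi m}. (\<Prod>j\<in>{?lo m..<?hi m} - V. q ^ nat (j + 1))
      * f m V * of_nat (card (lifts V X)))" for m X
  proof (cases m)
    case 0
    have lines: "down_line ?N = right_line 0 \<union> ?C" "up_line ?N = right_line 0"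
      using leftN by (simp_all add: up_line_def down_line_def)
    have dn: "down_line ?N \<inter> up_line ?N = right_line 0" using lines by auto
    have diff: "down_line ?N - (right_line 0 - V) = V \<union> ?C" if "V \<subseteq> right_line 0" for V
      using that unfolding lines right0 by auto
    have "f (Suc m) X = (\<Sum>V\<in>Pow (right_line 0). (\<Prod>j\<in>right_line 0 - V. q ^ nat (j + 1))
      * strip_gf q up_line down_line ?N (V \<union> ?C) * of_nat (card (lifts V X)))"
    proof -
      have "f (Suc m) X = (\<Sum>J\<in>Pow (right_line 0). (\<Prod>j\<in>J. q ^ nat (j + 1))
          * strip_gf q up_line down_line ?N (down_line ?N - J) * of_nat (card (lifts (right_line 0 - J) X)))"
        using 0 unfolding f_def by (simp add: dn[unfolded lines(2)] lines(2) del: Pow_Int_eq)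
      also have "\<dots> = (\<Sum>V\<in>Pow (right_line 0). (\<Prod>j\<in>right_line 0 - V. q ^ nat (j + 1))
          * strip_gf q up_line down_line ?N (V \<union> ?C) * of_nat (card (lifts V X)))"
        by (rule trans[OF Pow_diff_reindex], rule sum.cong) (simp_all add: diff double_diff)
      finally show ?thesis .
    qed
    then show ?thesis using 0 unfolding right[symmetric] by (simp add: f_def)
  next
    case (Suc m')
    have lines: "down_line (?N + m) = right_line m" "up_line (?N + m) = right_line m"
      using Suc by (simp_all add: up_line_def down_line_def)
    show ?thesis unfolding right[symmetric]
      unfolding f_def using Suc lines
      by simp (rule trans[OF Pow_diff_reindex], rule sum.cong, simp_all add: double_diff)
  qed
  \<comment> \<open>If no column follows the cut, the final line is the cut itself and the extra set
    has to appear, as it does in \<open>f 0\<close>.\<close>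
  have last: "down_line (?N + ?k) = (if ?k = 0 then {0..<int z} \<union> ?C else {0..<int z})"
    unfolding down_line_def left_line_def right_line_def by auto
  have "M3 q (Q_region a b x y z t) = strip_gf q up_line down_line (?N + ?k) (down_line (?N + ?k))"
    unfolding Q_region_eq_strip by (rule M3_strip) (simp_all add: finite_lines)
  also have "\<dots> = f ?k {0..<0 + int z}"
    unfolding last f_def by auto
  also have "\<dots> = (\<Prod>l<?k. inverse (hole_wt q {?lo l..<?hi l}))
      * (\<Sum>V\<in>Pow {?lo 0..<?hi 0}. f 0 V * path_sum q ?k V {0..<0 + int z})"
    by (rule transfer_eq_path_sum[where M = ?k]) (use step in auto)
  also have "\<dots> = (\<Prod>l<?k. inverse (hole_wt q (right_line l)))
      * (\<Sum>H\<in>Pow {int a..<int (a + y + z)}. f 0 H * path_sum q ?k H {0..<0 + int z})"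
    by (simp only: right[symmetric] right0)
  also have "(\<Sum>H\<in>Pow {int a..<int (a + y + z)}. f 0 H * path_sum q ?k H {0..<0 + int z})
      = (\<Sum>H\<in>Pow {int a..<int (a + y + z)}. (\<Prod>l<?N. inverse (hole_wt q (left_line l)))
        * (path_sum q ?N {int (y + t)..<int (y + t) + int (z + a + b)} (H \<union> {0..<int a} \<union> {int (a + y + z)..<int (a + y + z + b)})
          * path_sum q ?k H {0..<0 + int z}))"
  proof (intro sum.cong refl)
    fix H assume "H \<in> Pow {int a..<int (a + y + z)}"
    then have "H \<union> ?C \<subseteq> left_line ?N" unfolding leftN right0 by auto
    from strip_gf_left[OF order.refl this]
    show "f 0 H * path_sum q ?k H {0..<0 + int z} = (\<Prod>l<?N. inverse (hole_wt q (left_line l)))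
        * (path_sum q ?N {int (y + t)..<int (y + t) + int (z + a + b)} (H \<union> {0..<int a} \<union> {int (a + y + z)..<int (a + y + z + b)})
          * path_sum q ?k H {0..<0 + int z})"
      unfolding f_def Un_assoc by (simp only: simp_thms if_True mult.assoc)
  qed
  finally show ?thesis unfolding sum_distrib_left[symmetric] by (simp only: mult_ac)
qed

end

section \<open>Evaluation\<close>

lemma two_choose_2: "2 * int (n choose 2) = int n * (int n - 1)"
proof (induction n)
  case (Suc n)
  have "Suc n choose 2 = (n choose 2) + n" by (simp add: numeral_2_eq_2)
  then show ?case using Suc by (simp add: algebra_simps)
qed (simp add: numeral_2_eq_2)

lemma six_choose_3: "6 * int (n choose 3) = int n * (int n - 1) * (int n - 2)"
proof (induction n)
  case (Suc n)
  have "Suc n choose 3 = (n choose 3) + (n choose 2)" by (simp add: numeral_3_eq_3 numeral_2_eq_2)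
  then show ?case using Suc two_choose_2[of n] by (simp add: algebra_simps)
qed (simp add: numeral_3_eq_3)

definition tri :: "int \<Rightarrow> int" where
  "tri n = n * (n + 1) div 2"

lemma two_tri: "2 * tri n = n * (n + 1)"
  by (simp add: tri_def)

text \<open>Tetrahedral numbers. They collect the lower ends of successive lines, which fall by one
  until they reach the bottom and stay there.\<close>

lemma sum_tri_truncated_below:
  "6 * (\<Sum>l<p + r. tri (max 0 (int p - int l))) = int p * (int p + 1) * (int p + 2)"
proof (induction p)
  case 0
  have "tri 0 = 0" by (simp add: tri_def)
  then show ?case by simp
next
  case (Suc p)
  have "(\<Sum>l<Suc p + r. tri (max 0 (int (Suc p) - int l)))
      = tri (int (Suc p)) + (\<Sum>l<p + r. tri (max 0 (int p - int l)))"
    unfolding add_Suc sum.lessThan_Suc_shift by simp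
  then show ?case using Suc two_tri[of "int (Suc p)"] by (simp add: algebra_simps)
qed

text \<open>Collects the upper ends of the lines: they stay at \<open>P\<close> for r lines and then
  fall by one per line. The falling part telescopes through the cubic n (n + 1) (n + 2).\<close>

lemma sum_tri_truncated_above:
  "6 * (\<Sum>l<r + s. tri (min P (P + int r - int l)))
    = 3 * int r * (P * (P + 1)) + P * (P + 1) * (P + 2) - (P - int s) * (P - int s + 1) * (P - int s + 2)"
proof (induction r)
  case 0
  have "6 * (\<Sum>l<s. tri (P - int l))
    = P * (P + 1) * (P + 2) - (P - int s) * (P - int s + 1) * (P - int s + 2)"
  proof (induction s)
    case (Suc s)
    then show ?case using two_tri[of "P - int s"] by (simp add: algebra_simps)
  qed simp
  moreover have "min P (P - int l) = P - int l" for l by simp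
  ultimately show ?case by simp
next
  case (Suc r)
  have "(\<Sum>l<Suc r + s. tri (min P (P + int (Suc r) - int l)))
      = tri P + (\<Sum>l<r + s. tri (min P (P + int r - int l)))"
    unfolding add_Suc sum.lessThan_Suc_shift by (simp add: algebra_simps)
  then show ?case using Suc two_tri[of P] by (simp add: algebra_simps)
qed

section \<open>Interval products as monomials in q and q - 1 times \<open>qH\<close>\<close>

context generic_q
begin

lemma powi_diff_qint:
  assumes "i < j"
  shows "q powi j - q powi i = q powi i * (q - 1) * qint q (nat (j - i))"
proof -
  have 1: "(q - 1) * qint q n = q ^ n - 1" for n
    unfolding qint_def by (simp add: power_diff_1_eq)
  have "q powi j = q powi i * q ^ nat (j - i)"
    using assms q_nonzero power_int_add[of q i "j - i"] by (simp add: power_int_def)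
  then show ?thesis unfolding mult.assoc 1 by (simp add: right_diff_distrib)
qed

lemma q_minus_1_nonzero: "q - 1 \<noteq> 0"
  using q_power_neq_1[of 1] by simp

lemma qint_nonzero:
  assumes "n > 0"
  shows "qint q n \<noteq> 0"
  using powi_diff_qint[of 0 "int n"] powi_less_neq[of 0 "int n"] assms by auto

lemma qH_nonzero: "qH q n \<noteq> 0"
  by (auto simp: qH_def qfact_def qint_nonzero)

definition qmono :: "int \<Rightarrow> int \<Rightarrow> 'a" where
  "qmono \<alpha> \<beta> = q powi \<alpha> * (q - 1) powi \<beta>"

lemma qmono_mult: "qmono \<alpha> \<beta> * qmono \<alpha>' \<beta>' = qmono (\<alpha> + \<alpha>') (\<beta> + \<beta>')"
  using q_nonzero q_minus_1_nonzero by (simp add: qmono_def power_int_add)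

lemma qmono_divide: "qmono \<alpha> \<beta> / qmono \<alpha>' \<beta>' = qmono (\<alpha> - \<alpha>') (\<beta> - \<beta>')"
  using q_nonzero q_minus_1_nonzero by (simp add: qmono_def power_int_diff)

lemma qmono_power: "qmono \<alpha> \<beta> ^ n = qmono (int n * \<alpha>) (int n * \<beta>)"
  by (induction n) (simp_all add: qmono_mult algebra_simps, simp add: qmono_def)

lemma hole_wt_interval:
  assumes "i \<le> j"
  shows "hole_wt q {i..<j} = qmono (tri i - tri j) 0"
proof -
  have "hole_wt q {i..<i + int n} = qmono (tri i - tri (i + int n)) 0" for n
  proof (induction n)
    case (Suc n)
    have ins: "{i..<i + int (Suc n)} = insert (i + int n) {i..<i + int n}" by auto
    have "tri (i + int (Suc n)) = tri (i + int n) + (i + int n + 1)"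
      using two_tri[of "i + int n"] two_tri[of "i + int (Suc n)"] by (simp add: algebra_simps)
    moreover have "hole_wt q {i..<i + int (Suc n)} = qmono (- (i + int n + 1)) 0 * hole_wt q {i..<i + int n}"
      unfolding ins by (simp add: hole_wt_def qmono_def)
    ultimately show ?case using Suc by (simp add: qmono_mult algebra_simps)
  qed (simp add: hole_wt_def qmono_def)
  from this[of "nat (j - i)"] assms show ?thesis by simp
qed

text \<open>The sum of the smaller element over all pairs in an interval of length n starting at i:
  each pair contributes this power of q when \<open>q powi j - q powi i\<close> is written with
  \<open>qint\<close>.\<close>

definition ivexp :: "int \<Rightarrow> nat \<Rightarrow> int" where
  "ivexp i n = i * int (n choose 2) + int (n choose 3)"

lemma six_ivexp: "6 * ivexp i n = 3 * i * int n * (int n - 1) + int n * (int n - 1) * (int n - 2)"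
proof -
  have "6 * ivexp i n = 3 * i * (2 * int (n choose 2)) + 6 * int (n choose 3)"
    by (simp add: ivexp_def algebra_simps)
  then show ?thesis unfolding two_choose_2 six_choose_3 by (simp add: algebra_simps)
qed

lemma qvand_interval:
  "qvand q {i..<i + int n} = qmono (ivexp i n) (int (n choose 2)) * qH q n"
proof (induction n)
  case 0
  show ?case by (simp add: qmono_def ivexp_def numeral_2_eq_2 numeral_3_eq_3 qH_def)
next
  case (Suc n)
  have ins: "{i..<i + int (Suc n)} = insert (i + int n) {i..<i + int n}" by auto
  have img: "{i..<i + int n} = (\<lambda>k. i + int k) ` {..<n}"
  proof (intro Set.set_eqI iffI)
    fix v assume "v \<in> {i..<i + int n}"
    then show "v \<in> (\<lambda>k. i + int k) ` {..<n}" by (intro image_eqI[of _ _ "nat (v - i)"]) auto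
  qed auto
  have "(\<Prod>s\<in>{i..<i + int n}. qdist q (i + int n) s) = (\<Prod>k<n. qmono (i + int k) 1 * qint q (n - k))"
    unfolding img
    by (subst prod.reindex) (auto intro!: prod.cong simp: inj_on_def qdist_def powi_diff_qint qmono_def nat_diff_distrib)
  also have "\<dots> = (\<Prod>k<n. qmono (i + int k) 1) * (\<Prod>k<n. qint q (n - k))"
    by (rule prod.distrib)
  also have "(\<Prod>k<n. qmono (i + int k) 1) = qmono (int n * i + int (n choose 2)) (int n)"
  proof (induction n)
    case (Suc n)
    have "Suc n choose 2 = (n choose 2) + n" by (simp add: numeral_2_eq_2)
    then show ?case using Suc by (simp add: qmono_mult algebra_simps)
  qed (simp add: qmono_def numeral_2_eq_2)
  also have "(\<Prod>k<n. qint q (n - k)) = qfact q n"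
    unfolding qfact_def by (rule prod.reindex_bij_witness[of _ "\<lambda>k. n - k" "\<lambda>k. n - k"]) auto
  finally have "qvand q {i..<i + int (Suc n)}
      = qmono (ivexp i n + (int n * i + int (n choose 2))) (int (n choose 2) + int n) * (qH q n * qfact q n)"
    unfolding ins using Suc by (subst qvand_insert) (simp_all add: mult_ac qmono_mult[symmetric])
  moreover have "Suc n choose 2 = (n choose 2) + n" "Suc n choose 3 = (n choose 3) + (n choose 2)"
    by (simp_all add: numeral_3_eq_3 numeral_2_eq_2)
  ultimately show ?case by (simp add: ivexp_def qH_def algebra_simps)
qed

text \<open>\<open>qvand_triple\<close>, with the gap between the two intervals as the remaining
  set, expresses the product through intervals alone.\<close>

lemma qvand_two_intervals:
  fixes i j k l :: int and m g n :: nat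
  assumes "j = i + int m" "k = j + int g" "l = k + int n"
  shows "qvand q ({i..<j} \<union> {k..<l}) =
    qmono (ivexp i (m + g + n) + ivexp i m + ivexp j g + ivexp k n - ivexp i (m + g) - ivexp j (g + n))
      (int (m choose 2) + int (n choose 2) + int m * int n)
    * (qH q (m + g + n) * qH q m * qH q g * qH q n / (qH q (m + g) * qH q (g + n)))"
proof -
  let ?T = "{i..<j}" and ?Y = "{j..<k}" and ?Z = "{k..<l}"
  have un: "?T \<union> ?Y = {i..<i + int (m + g)}" "?Y \<union> ?Z = {j..<j + int (g + n)}"
    "?T \<union> (?Y \<union> ?Z) = {i..<i + int (m + g + n)}"
    "?T = {i..<i + int m}" "?Y = {j..<j + int g}" "?Z = {k..<k + int n}"
    using assms by auto
  have tr: "qvand q (?T \<union> ?Y) * qvand q (?T \<union> ?Z) * qvand q (?Y \<union> ?Z)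
      = qvand q (?T \<union> (?Y \<union> ?Z)) * qvand q ?T * qvand q ?Y * qvand q ?Z"
    by (rule qvand_triple) (use assms in auto)
  have "qvand q (?T \<union> ?Z) = qvand q (?T \<union> (?Y \<union> ?Z)) * qvand q ?T * qvand q ?Y * qvand q ?Z
      / (qvand q (?T \<union> ?Y) * qvand q (?Y \<union> ?Z))"
    unfolding tr[symmetric] using qvand_nonzero[of "?T \<union> ?Y"] qvand_nonzero[of "?Y \<union> ?Z"] by simp
  also have "\<dots> = (qmono (ivexp i (m + g + n)) (int (m + g + n choose 2)) * qmono (ivexp i m) (int (m choose 2))
      * qmono (ivexp j g) (int (g choose 2)) * qmono (ivexp k n) (int (n choose 2))
      / (qmono (ivexp i (m + g)) (int (m + g choose 2)) * qmono (ivexp j (g + n)) (int (g + n choose 2))))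
    * (qH q (m + g + n) * qH q m * qH q g * qH q n / (qH q (m + g) * qH q (g + n)))"
    unfolding un(3) unfolding un(1,2) unfolding un(4-6) qvand_interval by (simp add: mult_ac)
  also have "qmono (ivexp i (m + g + n)) (int (m + g + n choose 2)) * qmono (ivexp i m) (int (m choose 2))
      * qmono (ivexp j g) (int (g choose 2)) * qmono (ivexp k n) (int (n choose 2))
      / (qmono (ivexp i (m + g)) (int (m + g choose 2)) * qmono (ivexp j (g + n)) (int (g + n choose 2)))
    = qmono (ivexp i (m + g + n) + ivexp i m + ivexp j g + ivexp k n - ivexp i (m + g) - ivexp j (g + n))
      (int (m choose 2) + int (n choose 2) + int m * int n)"
  proof -
    have "2 * (int (m + g + n choose 2) + int (m choose 2) + int (g choose 2) + int (n choose 2)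
        - (int (m + g choose 2) + int (g + n choose 2)))
        = 2 * (int (m choose 2) + int (n choose 2) + int m * int n)"
      unfolding right_diff_distrib distrib_left two_choose_2 by (simp add: algebra_simps)
    then show ?thesis unfolding qmono_mult qmono_divide
      by (intro arg_cong2[where f = qmono]) simp_all
  qed
  finally show ?thesis .
qed

end

context generic_q
begin

lemma prod_inverse_hole_wt_intervals:
  fixes lo hi :: "nat \<Rightarrow> int"
  assumes "\<And>l. l < n \<Longrightarrow> lo l \<le> hi l"
  shows "(\<Prod>l<n. inverse (hole_wt q {lo l..<hi l})) = qmono ((\<Sum>l<n. tri (hi l)) - (\<Sum>l<n. tri (lo l))) 0"
  using assms
proof (induction n)
  case (Suc n)
  have "inverse (qmono \<alpha> 0) = qmono (- \<alpha>) 0" for \<alpha>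
    by (simp add: qmono_def power_int_minus)
  then have "inverse (hole_wt q {lo n..<hi n}) = qmono (tri (hi n) - tri (lo n)) 0"
    using Suc.prems[of n] by (simp add: hole_wt_interval)
  then show ?case using Suc by (simp add: qmono_mult algebra_simps)
qed (simp add: qmono_def)

lemma two_hole_wt_interval_exponent:
  "2 * (tri i - tri (i + int n)) = - (int n * (2 * i + int n + 1))"
  unfolding right_diff_distrib two_tri by (simp add: algebra_simps)

text \<open>Separates the monomial factors from the \<open>qH\<close> factors (the variables
  beginning with r), so that exponents can be added without touching the rest.\<close>

lemma monomials_times_rest:
  fixes k1 k2 :: 'a
  shows "k1 * k2 * (u0 ^ n * e0 ^ k * e1 / (e0 * e1 ^ m * u1 ^ l)
      * (mY * rY * (mZ * rZ) / (mX * rX)) * (m5 * r5 * (m6 * r6) / (m7 * r7 * (m8 * r8)))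
      * (u1 ^ p * (m4 * r4) / (m9 * r9)))
    = (k1 * k2 * (u0 ^ n * e0 ^ k * e1 / (e0 * e1 ^ m * u1 ^ l))
      * (mY * mZ / mX) * (m5 * m6 / (m7 * m8)) * (u1 ^ p * m4 / m9))
      * (rY * rZ / rX * (r5 * r6 / (r7 * r8)) * (r4 / r9))"
  by (simp only: times_divide_times_eq times_divide_eq_left times_divide_eq_right divide_divide_eq_left mult_ac)

end

lemma qH_ratio_eq:
  fixes g :: "'a::field"
  assumes "W \<noteq> 0" "XC \<noteq> 0" "CT \<noteq> 0" "AYZ \<noteq> 0" "YZB \<noteq> 0" "XA \<noteq> 0" "YZ \<noteq> 0" "BT \<noteq> 0" "XAYZ \<noteq> 0"
    "YZBT \<noteq> 0" "XYT \<noteq> 0" "YAB \<noteq> 0" "KY \<noteq> 0"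
  shows "g * (W * X * C * T / (XC * CT) * (C * A * YZ * B / (AYZ * YZB)) / (W * XA * YZ * BT / (XAYZ * YZBT))
      * (K * Y / (XYT * YAB)) * (G * XYA * Z * YBT / (XAYZ * YZBT) / KY))
      * (XA * BT * YAB * (CT * KY * XC) * (XYT * AYZ * YZB))
    = g * (X * Y * Z * T * A * B) * (G * K) * (XYA * YBT * C\<^sup>2)"
  using assms by (simp add: field_simps power2_eq_square)

section \<open>Assembly of exponents and factors\<close>

context generic_Q
begin

lemma prod_left_lines:
  obtains \<kappa> where "(\<Prod>l<x + y + t. inverse (hole_wt q (left_line l))) = qmono \<kappa> 0"
    "6 * \<kappa> = 3 * int (x + y) * (int (y + t + z + a + b) * (int (y + t + z + a + b) + 1))
      + int (y + t + z + a + b) * (int (y + t + z + a + b) + 1) * (int (y + t + z + a + b) + 2)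
      - int (y + z + a + b) * (int (y + z + a + b) + 1) * (int (y + z + a + b) + 2)
      - int (y + t) * (int (y + t) + 1) * (int (y + t) + 2)"
proof -
  define P where "P = int (y + t + z + a + b)"
  have hi: "int (y + z + a + b + (x + y + t)) = P + int (x + y)" by (simp add: P_def)
  have low: "y + t + x = x + y + t" by simp
  have "(\<Prod>l<x + y + t. inverse (hole_wt q (left_line l)))
      = qmono ((\<Sum>l<x + y + t. tri (min P (P + int (x + y) - int l)))
          - (\<Sum>l<x + y + t. tri (max 0 (int (y + t) - int l)))) 0"
    unfolding left_line_def P_def[symmetric] hi
    by (rule prod_inverse_hole_wt_intervals) (auto simp: P_def)
  moreover have "6 * ((\<Sum>l<x + y + t. tri (min P (P + int (x + y) - int l)))
          - (\<Sum>l<x + y + t. tri (max 0 (int (y + t) - int l))))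
      = 3 * int (x + y) * (P * (P + 1)) + P * (P + 1) * (P + 2)
        - (P - int t) * (P - int t + 1) * (P - int t + 2) - int (y + t) * (int (y + t) + 1) * (int (y + t) + 2)"
    using sum_tri_truncated_above[where r = "x + y" and s = t and P = P]
      sum_tri_truncated_below[of "y + t" x, unfolded low]
    by (simp only: right_diff_distrib)
  moreover have "P - int t = int (y + z + a + b)" by (simp add: P_def)
  ultimately show ?thesis using that by (simp only: P_def[symmetric])
qed

lemma prod_right_lines:
  obtains \<kappa> where "(\<Prod>l<y + a + b. inverse (hole_wt q (right_line l))) = qmono \<kappa> 0"
    "6 * \<kappa> = 3 * int b * (int (a + y + z) * (int (a + y + z) + 1))
      + int (a + y + z) * (int (a + y + z) + 1) * (int (a + y + z) + 2)
      - int z * (int z + 1) * (int z + 2) - int a * (int a + 1) * (int a + 2)"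
proof -
  define P where "P = int (a + y + z)"
  have hi: "int (y + z + a + b) = P + int b" by (simp add: P_def)
  have n: "a + (y + b) = y + a + b" "b + (y + a) = y + a + b" by simp_all
  have "(\<Prod>l<y + a + b. inverse (hole_wt q (right_line l)))
      = qmono ((\<Sum>l<y + a + b. tri (min P (P + int b - int l)))
          - (\<Sum>l<y + a + b. tri (max 0 (int a - int l)))) 0"
    unfolding right_line_def P_def[symmetric] hi
    by (rule prod_inverse_hole_wt_intervals) (auto simp: P_def)
  moreover have "6 * ((\<Sum>l<y + a + b. tri (min P (P + int b - int l)))
          - (\<Sum>l<y + a + b. tri (max 0 (int a - int l))))
      = 3 * int b * (P * (P + 1)) + P * (P + 1) * (P + 2)
        - (P - int (y + a)) * (P - int (y + a) + 1) * (P - int (y + a) + 2) - int a * (int a + 1) * (int a + 2)"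
    using sum_tri_truncated_above[where r = b and s = "y + a" and P = P, unfolded n]
      sum_tri_truncated_below[of a "y + b", unfolded n]
    by (simp only: right_diff_distrib)
  moreover have "P - int (y + a) = int z" by (simp add: P_def)
  ultimately show ?thesis using that by (simp only: P_def[symmetric])
qed

theorem M3_Q_region_generic:
  "M3 q (Q_region a b x y z t)
    * (qH q (a + x) * qH q (b + t) * qH q (a + b + y)
      * (qH q (a + b + y + z + t) * qH q (a + b + x + 2 * y + t) * qH q (a + b + x + y + z))
      * (qH q (x + y + t) * qH q (a + y + z) * qH q (b + y + z)))
    = q ^ (b * (a + y + 1 choose 2) + y * (a + y + t + 1 choose 2) + x * (y + t + 1 choose 2))
      * (qH q x * qH q y * qH q z * qH q t * qH q a * qH q b)
      * (qH q (a + b + x + 2 * y + z + t) * qH q (a + b + x + y + t))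
      * (qH q (a + x + y) * qH q (b + y + t) * (qH q (a + b + y + z))\<^sup>2)"
proof -
  define c where "c = y + z + a + b"
  define s where "s = y + a + b + t"
  obtain \<kappa>\<^sub>1 where \<kappa>\<^sub>1: "(\<Prod>l<x + y + t. inverse (hole_wt q (left_line l))) = qmono \<kappa>\<^sub>1 0"
    "6 * \<kappa>\<^sub>1 = 3 * int (x + y) * (int (y + t + z + a + b) * (int (y + t + z + a + b) + 1))
      + int (y + t + z + a + b) * (int (y + t + z + a + b) + 1) * (int (y + t + z + a + b) + 2)
      - int (y + z + a + b) * (int (y + z + a + b) + 1) * (int (y + z + a + b) + 2)
      - int (y + t) * (int (y + t) + 1) * (int (y + t) + 2)"
    by (rule prod_left_lines)
  obtain \<kappa>\<^sub>2 where \<kappa>\<^sub>2: "(\<Prod>l<y + a + b. inverse (hole_wt q (right_line l))) = qmono \<kappa>\<^sub>2 0"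
    "6 * \<kappa>\<^sub>2 = 3 * int b * (int (a + y + z) * (int (a + y + z) + 1))
      + int (a + y + z) * (int (a + y + z) + 1) * (int (a + y + z) + 2)
      - int z * (int z + 1) * (int z + 2) - int a * (int a + 1) * (int a + 2)"
    by (rule prod_right_lines)
  define u0 where "u0 = tri (int (y + t)) - tri (int (y + t) + int (z + a + b))"
  define u1 where "u1 = tri (int s) - tri (int s + int z)"
  define e0 where "e0 = tri 0 - tri (0 + int z)"
  define e1 where "e1 = tri (int a) - tri (int a + int z)"
  have hw: "hole_wt q {int (y + t)..<int (y + t) + int (z + a + b)} = qmono u0 0"
    "hole_wt q {int s..<int s + int z} = qmono u1 0"
    "hole_wt q {0..<0 + int z} = qmono e0 0"
    "hole_wt q {int a..<int a + int z} = qmono e1 0"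
    unfolding u0_def u1_def e0_def e1_def by (rule hole_wt_interval; simp)+
  define ex where "ex i m g n = ivexp i (m + g + n) + ivexp i m + ivexp (i + int m) g
      + ivexp (i + int m + int g) n - ivexp i (m + g) - ivexp (i + int m) (g + n)" for i m g n
  define fx where "fx m n = int (m choose 2) + int (n choose 2) + int m * int n" for m n
  define R where "R m g n = qH q (m + g + n) * qH q m * qH q g * qH q n / (qH q (m + g) * qH q (g + n))" for m g n
  have two: "qvand q ({i..<j} \<union> {k..<l}) = qmono (ex i m g n) (fx m n) * R m g n"
    if "j = i + int m" "k = i + int m + int g" "l = i + int m + int g + int n" for i j k l m g n
    using qvand_two_intervals[of j i m k g l n] that unfolding ex_def fx_def R_def by simp
  have vY: "qvand q ({- int x..<0} \<union> {int c..<int (c + t)}) = qmono (ex (- int x) x c t) (fx x t) * R x c t"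
    by (rule two) auto
  have vZ: "qvand q ({0..<int a} \<union> {int (a + y + z)..<int (a + y + z + b)})
      = qmono (ex 0 a (y + z) b) (fx a b) * R a (y + z) b"
    by (rule two) auto
  \<comment> \<open>Each triangle side is adjacent to one of the outer intervals and merges with it,
    which leaves two intervals with a gap of length \<open>y + z\<close>.\<close>
  have YZ: "{- int x..<0} \<union> {int c..<int (c + t)} \<union> ({0..<int a} \<union> {int (a + y + z)..<int (a + y + z + b)})
      = {- int x..<int a} \<union> {int (a + y + z)..<int (c + t)}"
    by (auto simp: c_def)
  have vX: "qvand q ({- int x..<0} \<union> {int c..<int (c + t)} \<union> ({0..<int a} \<union> {int (a + y + z)..<int (a + y + z + b)}))
      = qmono (ex (- int x) (x + a) (y + z) (b + t)) (fx (x + a) (b + t)) * R (x + a) (y + z) (b + t)"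
    unfolding YZ by (rule two) (auto simp: c_def)
  have v: "qvand q {i..<j} = qmono (ivexp i n) (int (n choose 2)) * qH q n" if "j = i + int n" for i j n
    unfolding that by (rule qvand_interval)
  have v5: "qvand q {- int x..<int s} = qmono (ivexp (- int x) (x + s)) (int (x + s choose 2)) * qH q (x + s)"
    by (rule v) simp
  have v6: "qvand q {int a + int z..<int a + int z + int y}
      = qmono (ivexp (int a + int z) y) (int (y choose 2)) * qH q y"
    by (rule v) simp
  have v7: "qvand q {- int x..<int (y + t)}
      = qmono (ivexp (- int x) (x + y + t)) (int (x + y + t choose 2)) * qH q (x + y + t)"
    by (rule v) simp
  have v8: "qvand q {int z..<int z + int (y + a + b)}
      = qmono (ivexp (int z) (y + a + b)) (int (y + a + b choose 2)) * qH q (y + a + b)"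
    by (rule v) simp
  have k: "x + y + a + b + t = x + s" "y + a + b + t = s" "y + z + a + b = c" by (simp_all add: s_def c_def)
  have low: "int s - int (x + s + y) = - int (x + y)" by simp
  have diff: "{- int (x + y)..<int s + int z} - {int a..<int a + int z}
      = {- int (x + y)..<int a} \<union> {int (a + z)..<int (a + z) + int (y + b + t)}"
    by (auto simp: s_def)
  have v4: "qvand q ({- int (x + y)..<int s + int z} - {int a..<int a + int z})
      = qmono (ex (- int (x + y)) (x + y + a) z (y + b + t)) (fx (x + y + a) (y + b + t)) * R (x + y + a) z (y + b + t)"
    unfolding diff by (rule two) auto
  have v9: "qvand q {- int (x + y)..<int s}
      = qmono (ivexp (- int (x + y)) (x + s + y)) (int (x + s + y choose 2)) * qH q (x + s + y)"
    by (rule v) simp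
  have ps: "path_sum q (x + s + y) {int s..<int s + int z} {int a..<int a + int z}
      = hole_wt q {int s..<int s + int z} ^ (x + s + y) * qvand q ({- int (x + y)..<int s + int z} - {int a..<int a + int z})
        / qvand q {- int (x + y)..<int s}"
    unfolding low[symmetric] by (rule path_sum_from_interval) (auto simp: s_def)
  define E where "E = \<kappa>\<^sub>1 + \<kappa>\<^sub>2 + (int (x + y + t) * u0 + int (y + a + b) * e0 + e1
      - (e0 + int y * e1 + int (x + s) * u1))
      + (ex (- int x) x c t + ex 0 a (y + z) b - ex (- int x) (x + a) (y + z) (b + t))
      + (ivexp (- int x) (x + s) + ivexp (int a + int z) y
        - (ivexp (- int x) (x + y + t) + ivexp (int z) (y + a + b)))
      + (int (x + s + y) * u1 + ex (- int (x + y)) (x + y + a) z (y + b + t)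
        - ivexp (- int (x + y)) (x + s + y))"
  define F where "F = (fx x t + fx a b - fx (x + a) (b + t))
      + (int (x + s choose 2) + int (y choose 2) - (int (x + y + t choose 2) + int (y + a + b choose 2)))
      + (fx (x + y + a) (y + b + t) - int (x + s + y choose 2))"
  have M3: "M3 q (Q_region a b x y z t) = qmono E F
      * (R x c t * R a (y + z) b / R (x + a) (y + z) (b + t)
        * (qH q (x + s) * qH q y / (qH q (x + y + t) * qH q (y + a + b)))
        * (R (x + y + a) z (y + b + t) / qH q (x + s + y)))"
    unfolding M3_Q_region_eq_path_sum two_gap_sum_eq_path_sum k \<kappa>\<^sub>1(1) \<kappa>\<^sub>2(1) ps v4 v5 v6 v7 v8 v9 vX unfolding vY vZ hw
    unfolding monomials_times_rest unfolding qmono_mult qmono_divide qmono_power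
    unfolding E_def F_def by (simp only: mult_zero_right add_0 add_0_right diff_zero)
  \<comment> \<open>The powers of q - 1 cancel, as they must in a formula that survives at q =
    1.\<close>
  have "2 * F = 0"
    unfolding F_def fx_def s_def right_diff_distrib distrib_left two_choose_2 by (simp add: algebra_simps)
  then have F: "F = 0" by simp
  have six_ex: "6 * ex i m g n = 6 * ivexp i (m + g + n) + 6 * ivexp i m + 6 * ivexp (i + int m) g
      + 6 * ivexp (i + int m + int g) n - 6 * ivexp i (m + g) - 6 * ivexp (i + int m) (g + n)" for i m g n
    by (simp add: ex_def)
  \<comment> \<open>The factor 6 clears the denominators of \<open>tri\<close> and of the binomials
    of order 2 and 3; what remains is a polynomial identity in the six side parameters.\<close>
  have "6 * E = 6 * \<kappa>\<^sub>1 + 6 * \<kappa>\<^sub>2 + (3 * int (x + y + t) * (2 * u0) + 3 * int (y + a + b) * (2 * e0) + 3 * (2 * e1)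
      - (3 * (2 * e0) + 3 * int y * (2 * e1) + 3 * int (x + s) * (2 * u1)))
      + (6 * ex (- int x) x c t + 6 * ex 0 a (y + z) b - 6 * ex (- int x) (x + a) (y + z) (b + t))
      + (6 * ivexp (- int x) (x + s) + 6 * ivexp (int a + int z) y
        - (6 * ivexp (- int x) (x + y + t) + 6 * ivexp (int z) (y + a + b)))
      + (3 * int (x + s + y) * (2 * u1) + 6 * ex (- int (x + y)) (x + y + a) z (y + b + t)
        - 6 * ivexp (- int (x + y)) (x + s + y))"
    unfolding E_def by (simp add: algebra_simps)
  also have "\<dots> = 3 * (int b * ((int a + int y + 1) * (int a + int y)) + int y * ((int a + int y + int t + 1) * (int a + int y + int t))
      + int x * ((int y + int t + 1) * (int y + int t)))"
    unfolding \<kappa>\<^sub>1(2) \<kappa>\<^sub>2(2) six_ex six_ivexp u0_def u1_def e0_def e1_def two_hole_wt_interval_exponent c_def s_def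
    unfolding of_nat_add by Groebner_Basis.algebra
  also have "\<dots> = 3 * (int b * (2 * int (a + y + 1 choose 2)) + int y * (2 * int (a + y + t + 1 choose 2))
      + int x * (2 * int (y + t + 1 choose 2)))"
    unfolding two_choose_2 of_nat_add of_nat_1 by Groebner_Basis.algebra
  finally have "E = int (b * (a + y + 1 choose 2) + y * (a + y + t + 1 choose 2) + x * (y + t + 1 choose 2))"
    by (simp add: algebra_simps)
  then have mono: "qmono E F = q ^ (b * (a + y + 1 choose 2) + y * (a + y + t + 1 choose 2) + x * (y + t + 1 choose 2))"
    unfolding F qmono_def by (simp only: power_int_of_nat power_int_0_right mult_1_right)
  have args: "a + (y + z) + b = c" "x + a + (y + z) + (b + t) = x + c + t" "x + a + (y + z) = x + y + a + z"
    "y + z + (b + t) = z + (y + b + t)" "a + x = x + a" "a + b + y = y + a + b" "a + b + y + z + t = c + t"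
    "a + b + x + 2 * y + t = x + s + y" "a + b + x + y + z = x + c" "a + y + z = a + (y + z)"
    "b + y + z = y + z + b" "a + b + x + 2 * y + z + t = x + y + a + z + (y + b + t)"
    "a + b + x + y + t = x + s" "a + x + y = x + y + a" "b + y + t = y + b + t" "a + b + y + z = c"
    by (simp_all add: c_def s_def)
  show ?thesis
    unfolding M3 mono R_def args[THEN arg_cong[where f = "qH q"]] by (rule qH_ratio_eq) (simp_all add: qH_nonzero)
qed

end

section \<open>Specialisation of the indeterminate\<close>

locale semiring_hom_fun =
  fixes h :: "'a::comm_semiring_1 \<Rightarrow> 'b::comm_semiring_1"
  assumes h_0: "h 0 = 0" and h_1: "h 1 = 1"
    and h_add: "h (u + v) = h u + h v" and h_mult: "h (u * v) = h u * h v"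
begin

lemma h_sum: "h (sum f A) = (\<Sum>i\<in>A. h (f i))"
  by (induction A rule: infinite_finite_induct) (simp_all add: h_0 h_add)

lemma h_prod: "h (prod f A) = (\<Prod>i\<in>A. h (f i))"
  by (induction A rule: infinite_finite_induct) (simp_all add: h_1 h_mult)

lemma h_power: "h (u ^ n) = h u ^ n"
  by (induction n) (simp_all add: h_1 h_mult)

lemma h_M3: "h (M3 q R) = M3 (h q) R"
proof -
  have "h (wt3 q L) = wt3 (h q) L" for L by (simp add: wt3_def h_power h_1)
  then show ?thesis by (simp add: M3_def tiling_gf_def h_sum h_prod)
qed

lemma h_qH: "h (qH q n) = qH (h q) n"
  by (simp add: qH_def qfact_def qint_def h_prod h_sum h_power)

end

lemma semiring_hom_to_fract: "semiring_hom_fun (to_fract :: 'a::idom \<Rightarrow> 'a fract)"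
  by unfold_locales simp_all

lemma semiring_hom_poly: "semiring_hom_fun (\<lambda>p. poly p (v :: 'a::comm_ring_1))"
  by unfold_locales simp_all

lemma generic_q_indeterminate: "generic_q (to_fract [:0, 1:] :: 'a::field poly fract)"
proof
  show "to_fract [:0, 1:] \<noteq> (0 :: 'a poly fract)" by simp
next
  interpret semiring_hom_fun "to_fract :: 'a poly \<Rightarrow> 'a poly fract" by (rule semiring_hom_to_fract)
  fix n :: nat assume n: "n > 0"
  have "degree ([:0, 1:] ^ n :: 'a poly) = n" by (simp add: degree_power_eq)
  then have "([:0, 1:] ^ n :: 'a poly) \<noteq> 1" using n by auto
  then have "to_fract ([:0, 1:] ^ n :: 'a poly) \<noteq> to_fract 1" by (simp only: to_fract_eq_iff simp_thms)
  then show "to_fract [:0, 1:] ^ n \<noteq> (1 :: 'a poly fract)" by (simp add: h_power)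
qed

text \<open>Without denominators both sides are values of polynomials at q. The identity holds in
  the fraction field, where the indeterminate is generic, hence in the polynomial ring because the
  embedding is injective, and evaluation carries it to every q.\<close>

lemma M3_Q_region_cleared:
  fixes q :: "'a::field"
  shows "M3 q (Q_region a b x y z t)
    * (qH q (a + x) * qH q (b + t) * qH q (a + b + y)
      * (qH q (a + b + y + z + t) * qH q (a + b + x + 2 * y + t) * qH q (a + b + x + y + z))
      * (qH q (x + y + t) * qH q (a + y + z) * qH q (b + y + z)))
    = q ^ (b * (a + y + 1 choose 2) + y * (a + y + t + 1 choose 2) + x * (y + t + 1 choose 2))
      * (qH q x * qH q y * qH q z * qH q t * qH q a * qH q b)
      * (qH q (a + b + x + 2 * y + z + t) * qH q (a + b + x + y + t))
      * (qH q (a + x + y) * qH q (b + y + t) * (qH q (a + b + y + z))\<^sup>2)"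
    (is "?L q = ?R q")
proof -
  let ?X = "[:0, 1:] :: 'a poly"
  interpret F: semiring_hom_fun "to_fract :: 'a poly \<Rightarrow> 'a poly fract" by (rule semiring_hom_to_fract)
  interpret P: semiring_hom_fun "\<lambda>p. poly p q" by (rule semiring_hom_poly)
  interpret generic_Q "to_fract ?X" a b x y z t
    unfolding generic_Q_def by (rule generic_q_indeterminate)
  let ?LX = "M3 ?X (Q_region a b x y z t)
    * (qH ?X (a + x) * qH ?X (b + t) * qH ?X (a + b + y)
      * (qH ?X (a + b + y + z + t) * qH ?X (a + b + x + 2 * y + t) * qH ?X (a + b + x + y + z))
      * (qH ?X (x + y + t) * qH ?X (a + y + z) * qH ?X (b + y + z)))"
  let ?RX = "?X ^ (b * (a + y + 1 choose 2) + y * (a + y + t + 1 choose 2) + x * (y + t + 1 choose 2))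
      * (qH ?X x * qH ?X y * qH ?X z * qH ?X t * qH ?X a * qH ?X b)
      * (qH ?X (a + b + x + 2 * y + z + t) * qH ?X (a + b + x + y + t))
      * (qH ?X (a + x + y) * qH ?X (b + y + t) * (qH ?X (a + b + y + z))\<^sup>2)"
  have "to_fract ?LX = to_fract ?RX"
    unfolding F.h_mult F.h_power F.h_M3 F.h_qH by (rule M3_Q_region_generic)
  then have "?LX = ?RX" by (simp only: to_fract_eq_iff)
  then have "poly ?LX q = poly ?RX q" by (rule arg_cong)
  moreover have "poly ?X q = q" by simp
  ultimately show ?thesis
    unfolding P.h_mult P.h_power P.h_M3 P.h_qH by (simp only:)
qed

theorem theorem3p2:
  fixes q :: "'a::field" and a b x y z t :: nat
  assumes q: "\<And>n. n > 0 \<Longrightarrow> qint q n \<noteq> 0"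
  shows "M3 q (Q_region a b x y z t) =
      q ^ (b * (a + y + 1 choose 2) + y * (a + y + t + 1 choose 2) + x * (y + t + 1 choose 2))
      * (qH q x * qH q y * qH q z * qH q t * qH q a * qH q b
         / (qH q (a + x) * qH q (b + t) * qH q (a + b + y)))
      * (qH q (a + b + x + 2 * y + z + t) * qH q (a + b + x + y + t)
         / (qH q (a + b + y + z + t) * qH q (a + b + x + 2 * y + t) * qH q (a + b + x + y + z)))
      * (qH q (a + x + y) * qH q (b + y + t) * (qH q (a + b + y + z))\<^sup>2
         / (qH q (x + y + t) * qH q (a + y + z) * qH q (b + y + z)))"
proof -
  have nz: "qH q n \<noteq> 0" for n
    by (auto simp: qH_def qfact_def q)
  have ratio: "u = g * (n1 / d1) * (n2 / d2) * (n3 / d3)"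
    if "u * (d1 * d2 * d3) = g * n1 * n2 * n3" "d1 \<noteq> 0" "d2 \<noteq> 0" "d3 \<noteq> 0" for u g n1 n2 n3 d1 d2 d3 :: 'a
    using that by (simp add: field_simps)
  show ?thesis
    by (rule ratio) (use M3_Q_region_cleared[of q a b x y z t] in \<open>simp_all add: nz\<close>)
qed

end
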